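(* Let $a<q$ be positive integers with $\gcd(a,q)=1$, let $\Lambda$ denote the von Mangoldt function and let $\varepsilon>0$ be a small number. Then, as $x\to\infty$, \[ \sum_{n\leq x} \Lambda\left( q[x/n]+a \right) = c(a,q)\, x + O\left( x^{(2+\varepsilon)/3}\log^2 x \right), \] where the density constant is \[ c(a,q)=\sum_{n\geq 1}\frac{\Lambda(qn+a)}{n(n+1)}>0. \]
   Context: $[t]$ denotes the largest integer not exceeding $t$. The von Mangoldt function is $\Lambda(m)=\log p$ if $m=p^k$ for a prime $p$ and an integer $k\geq 1$, and $\Lambda(m)=0$ otherwise. The sum is over positive integers $n\le x$. *)

theory Defs
  imports "HOL-Analysis.Analysis" "HOL-Number_Theory.Number_Theory" "HOL-Library.Landau_Symbols"
begin

definition dens_const :: "nat \<Rightarrow> nat \<Rightarrow> real" where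
  "dens_const a q = (\<Sum>n. mangoldt (q * Suc n + a) / (real (Suc n) * real (Suc n + 1)))"

end

theory Submission
  imports Defs "HOL-Computational_Algebra.Squarefree"
begin

text \<open>
  Grouping the \<open>n\<close> with \<open>[x/n] = m\<close> gives \<open>x/(m(m+1)) + O(1)\<close> terms for each \<open>m \<le> \<surd>x\<close>, and only
  \<open>O(\<surd>x)\<close> values of \<open>n\<close> remain; so the trivial bound \<open>\<Lambda>(k) \<le> log k\<close> already yields the error
  \<open>O(\<surd>x log x)\<close>.

  Positivity of the density needs a prime power \<open>qm + a\<close> with \<open>m \<ge> 1\<close>, which is Dirichlet's theorem in
  disguise. It follows from the divergence of the sum of \<open>\<Lambda>(n)/n\<close> over \<open>n \<equiv> a (mod q)\<close>, which is
  isolated by characters. Write \<open>S(\<xi>, N)\<close> for the sum of \<open>\<xi>(n)\<Lambda>(n)/n\<close> over \<open>n \<le> N\<close>.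
  For nonprincipal \<open>\<xi>\<close>, convolving with \<open>\<Lambda> * 1 = log\<close> shows that \<open>S(\<xi>, N)\<close> is bounded if
  \<open>L(1, \<xi>) \<noteq> 0\<close>, and Moebius inversion shows \<open>S(\<xi>, N) = - log N + O(1)\<close> if \<open>L(1, \<xi>) = 0\<close>. Since the
  sum of \<open>S(\<xi>, N)\<close> over all characters is nonnegative and the principal character contributes
  \<open>log N + O(1)\<close>, at most one \<open>L(1, \<xi>)\<close> vanishes, and then \<open>\<xi>\<close> is real. The real case is excluded by
  Monsky's argument: if \<open>L(1, \<xi>) = 0\<close>, the Lambert series of \<open>\<xi>(n) t^n/(1 - t^n)\<close> stays bounded as
  \<open>t\<close> tends to \<open>1\<close>, although its power series coefficients are nonnegative and at least \<open>1\<close> at squares.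
\<close>

section \<open>Divisor sums, Chebyshev's bound and the Moebius function\<close>

text \<open>Writing \<open>n = d * m\<close>, both sides run over the pairs of positive integers
  with \<open>d * m \<le> N\<close>.\<close>

lemma sum_divisors_swap:
  fixes g :: "nat \<Rightarrow> nat \<Rightarrow> 'a::comm_monoid_add"
  shows "(\<Sum>n=1..N. \<Sum>d | d dvd n. g d (n div d)) = (\<Sum>d=1..N. \<Sum>m=1..N div d. g d m)"
proof -
  have "(\<Sum>n=1..N. \<Sum>d | d dvd n. g d (n div d))
      = (\<Sum>(n, d)\<in>(SIGMA n:{1..N}. {d. d dvd n}). g d (n div d))"
    by (subst sum.Sigma) auto
  also have "\<dots> = (\<Sum>(d, m)\<in>(SIGMA d:{1..N}. {1..N div d}). g d m)"
  proof (rule sum.reindex_bij_witness[where i = "\<lambda>(d, m). (d * m, d)" and j = "\<lambda>(n, d). (d, n div d)"], goal_cases)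
    case (2 p)
    then obtain n d where p: "p = (n, d)" "1 \<le> n" "n \<le> N" "d dvd n" by auto
    then have "d \<le> n" by (auto intro: dvd_imp_le)
    with p show ?case
      by (auto simp: div_le_mono Suc_le_eq div_greater_zero_iff intro: Nat.gr0I)
  next
    case (4 p)
    then obtain d m where p: "p = (d, m)" "1 \<le> d" "d \<le> N" "1 \<le> m" "m \<le> N div d" by auto
    then have "d * m \<le> N"
      by (metis mult.commute div_times_less_eq_dividend le_trans mult_le_mono1)
    with p show ?case by auto
  qed auto
  also have "\<dots> = (\<Sum>d=1..N. \<Sum>m=1..N div d. g d m)"
    by (subst sum.Sigma) auto
  finally show ?thesis .
qed

lemma ln_fact_eq_sum_ln: "ln (fact N :: real) = (\<Sum>n=1..N. ln (real n))"
  by (induction N) (simp_all add: ln_mult)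

text \<open>Legendre's formula in logarithmic form: sum \<open>\<Lambda> * 1 = log\<close> over
  \<open>n \<le> N\<close> and count the multiples of each \<open>d\<close>.\<close>

lemma ln_fact_eq_sum_mangoldt:
  "ln (fact N :: real) = (\<Sum>d=1..N. mangoldt d * real (N div d))"
proof -
  have "ln (fact N :: real) = (\<Sum>n=1..N. \<Sum>d | d dvd n. mangoldt d)"
    unfolding ln_fact_eq_sum_ln by (intro sum.cong) (auto simp: mangoldt_sum)
  also have "\<dots> = (\<Sum>d=1..N. \<Sum>m=1..N div d. mangoldt d)"
    by (rule sum_divisors_swap)
  finally show ?thesis by (simp add: mult.commute)
qed

lemma ln_fact_le: "ln (fact N :: real) \<le> real N * ln (real N)"
proof -
  have "ln (fact N :: real) \<le> (\<Sum>n=1..N. ln (real N))"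
    unfolding ln_fact_eq_sum_ln by (intro sum_mono) auto
  then show ?thesis by simp
qed

text \<open>A weak Stirling bound: \<open>N^N / N!\<close> is a single term of the exponential
  series of \<open>e^N\<close>.\<close>

lemma ln_fact_ge: "real N * ln (real N) - real N \<le> ln (fact N :: real)"
proof (cases "N = 0")
  case False
  have "real N ^ N / fact N \<le> exp (real N)"
  proof -
    have "(\<Sum>n\<in>{N}. real N ^ n /\<^sub>R fact n) \<le> (\<Sum>n. real N ^ n /\<^sub>R fact n)"
      by (intro sum_le_suminf summable_exp_generic) auto
    then show ?thesis by (simp add: exp_def field_simps)
  qed
  then have "ln (real N ^ N / fact N) \<le> real N"
    using False ln_mono[of "real N ^ N / fact N" "exp (real N)"] by simp
  then show ?thesis using False by (simp add: ln_div ln_realpow)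
qed auto

section \<open>Chebyshev's function and its linear upper bound\<close>

definition psi :: "nat \<Rightarrow> real" where
  "psi N = (\<Sum>d=1..N. mangoldt d)"

text \<open>By Legendre's formula the logarithm of the central binomial coefficient is the sum of
  \<open>\<Lambda>(d)\<close> with weights \<open>[2N/d] - 2[N/d]\<close>. These are never negative
  and equal 1 for \<open>N < d \<le> 2N\<close>, while the coefficient is at most
  \<open>4^N\<close>.\<close>

lemma psi_double_le: "psi (2 * N) - psi N \<le> 2 * real N * ln 2"
proof (cases "N = 0")
  case False
  have "psi (2 * N) - psi N = (\<Sum>d\<in>{N<..2*N}. mangoldt d)"
  proof -
    have "{1..2*N} = {1..N} \<union> {N<..2*N}" by auto
    moreover have "sum mangoldt ({1..N} \<union> {N<..2*N}) = sum mangoldt {1..N} + (sum mangoldt {N<..2*N} :: real)"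
      by (rule sum.union_disjoint) auto
    ultimately show ?thesis unfolding psi_def by simp
  qed
  also have "\<dots> \<le> (\<Sum>d=1..2*N. mangoldt d * (real (2 * N div d) - 2 * real (N div d)))"
  proof (rule sum_le_included[where i = id])
    show "\<forall>d\<in>{1..2*N}. 0 \<le> mangoldt d * (real (2 * N div d) - 2 * real (N div d))"
    proof
      fix d
      have "2 * (N div d) \<le> 2 * N div d"
        by (cases "d = 0") (auto simp: less_eq_div_iff_mult_less_eq)
      then have "0 \<le> real (2 * N div d) - 2 * real (N div d)" by linarith
      then show "0 \<le> mangoldt d * (real (2 * N div d) - 2 * real (N div d))"
        by (intro mult_nonneg_nonneg mangoldt_nonneg)
    qed
    show "\<forall>d\<in>{N<..2*N}. \<exists>y\<in>{1..2*N}. id y = d \<and> (mangoldt d :: real) \<le> mangoldt y * (real (2 * N div y) - 2 * real (N div y))"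
    proof
      fix d assume d: "d \<in> {N<..2*N}"
      then have "2 * N div d = 1" by (auto simp: div_nat_eqI)
      with d show "\<exists>y\<in>{1..2*N}. id y = d \<and> (mangoldt d :: real) \<le> mangoldt y * (real (2 * N div y) - 2 * real (N div y))"
        by auto
    qed
  qed auto
  also have "\<dots> = (\<Sum>d=1..2*N. mangoldt d * real (2 * N div d)) - 2 * (\<Sum>d=1..2*N. mangoldt d * real (N div d))"
    by (simp add: algebra_simps sum_subtractf sum_distrib_left)
  also have "(\<Sum>d=1..2*N. mangoldt d * real (N div d)) = (\<Sum>d=1..N. mangoldt d * real (N div d))"
    by (rule sum.mono_neutral_right) auto
  also have "(\<Sum>d=1..2*N. mangoldt d * real (2 * N div d)) - 2 * (\<Sum>d=1..N. mangoldt d * real (N div d))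
      = ln (fact (2 * N)) - 2 * ln (fact N)"
    by (simp only: ln_fact_eq_sum_mangoldt)
  also have "\<dots> = ln (real ((2 * N) choose N))"
    by (simp add: binomial_fact ln_div ln_mult)
  also have "\<dots> \<le> ln (real (2 ^ (2 * N)))"
    using binomial_le_pow2[of "2 * N" N]
    by (subst ln_le_cancel_iff) (auto simp del: of_nat_power simp: of_nat_le_iff)
  also have "\<dots> = 2 * real N * ln 2"
    by (simp add: ln_realpow)
  finally show ?thesis .
qed (simp add: psi_def)

lemma psi_mono: "M \<le> N \<Longrightarrow> psi M \<le> psi N"
  unfolding psi_def by (intro sum_mono2) (auto simp: mangoldt_nonneg)

text \<open>Repeated halving: \<open>N\<close> is replaced by \<open>N/2\<close> rounded up, and the
  doubling estimate pays for each step.\<close>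

lemma psi_le: "psi N \<le> 6 * real N"
proof (induction N rule: less_induct)
  case (less N)
  show ?case
  proof (cases "N \<ge> 2")
    case True
    define M where "M = (N + 1) div 2"
    have M: "M < N" "N \<le> 2 * M" "2 * M \<le> N + 1" using True unfolding M_def by auto
    have ln2: "ln 2 \<le> (7 / 10 :: real)"
      using ln2_le_25_over_36 by simp
    have "psi N \<le> psi (2 * M)" using M by (intro psi_mono) auto
    also have "\<dots> \<le> psi M + 2 * real M * ln 2" using psi_double_le[of M] by simp
    also have "\<dots> \<le> 6 * real M + 2 * real M * (7 / 10)"
      using less[OF M(1)] ln2 by (intro add_mono mult_left_mono) auto
    \<comment> \<open>The left side is \<open>7.4 M \<le> 3.7 (N + 1)\<close>, which is below
      \<open>6 N\<close> once \<open>N \<ge> 2\<close>; this is why 6 suffices.\<close>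
    also have "\<dots> \<le> 6 * real N" using M True by linarith
    finally show ?thesis .
  next
    case False
    then have "N = 0 \<or> N = 1" by auto
    then show ?thesis by (auto simp: psi_def)
  qed
qed

text \<open>Every divisor of \<open>p ^ k * m\<close> is \<open>p ^ i * d\<close> for exactly one
  pair with \<open>i \<le> k\<close> and \<open>d dvd m\<close>. Keeping \<open>h\<close> arbitrary
  lets the same splitting serve the Moebius function and real characters.\<close>

lemma sum_divisors_prime_power_mult:
  fixes g :: "nat \<Rightarrow> 'a::comm_semiring_0"
  assumes p: "prime p" and m: "\<not> p dvd m" and g: "\<And>i d. i \<le> k \<Longrightarrow> d dvd m \<Longrightarrow> g (p ^ i * d) = h i * g d"
  shows "(\<Sum>d | d dvd p ^ k * m. g d) = (\<Sum>i\<le>k. h i) * (\<Sum>d | d dvd m. g d)"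
proof -
  have "m \<noteq> 0" using m by (metis dvd_0_right)
  have "(\<Sum>i\<le>k. h i) * (\<Sum>d | d dvd m. g d) = (\<Sum>(i, d)\<in>{..k} \<times> {d. d dvd m}. h i * g d)"
    by (simp add: sum_product sum.cartesian_product)
  also have "\<dots> = (\<Sum>(i, d)\<in>{..k} \<times> {d. d dvd m}. g (p ^ i * d))"
    by (intro sum.cong) (auto simp: g)
  also have "\<dots> = (\<Sum>d | d dvd p ^ k * m. g d)"
  proof -
    have "bij_betw (\<lambda>(i, d). p ^ i * d) ({..k} \<times> {d. d dvd m}) {d. d dvd p ^ k * m}"
      unfolding bij_betw_def
    proof (intro conjI equalityI subsetI)
      have nd: "d dvd m \<Longrightarrow> \<not> p dvd d" for d using m dvd_trans by blast
      have mult: "d dvd m \<Longrightarrow> multiplicity p (p ^ i * d) = i" for i d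
        using nd[of d] p \<open>m \<noteq> 0\<close>
        by (intro multiplicity_eqI[of _ _ _, OF dvd_triv_left]) (auto simp: power_Suc2)
      show "inj_on (\<lambda>(i, d). p ^ i * d) ({..k} \<times> {d. d dvd m})"
      proof (rule inj_onI, clarsimp)
        fix i d j e assume "d dvd m" "e dvd m" and eq: "p ^ i * d = p ^ j * e"
        then have "i = j" using mult by metis
        with eq show "i = j \<and> d = e" using p by (auto simp: prime_gt_0_nat)
      qed
    next
      fix x assume "x \<in> (\<lambda>(i, d). p ^ i * d) ` ({..k} \<times> {d. d dvd m})"
      then show "x \<in> {d. d dvd p ^ k * m}" by (auto intro!: mult_dvd_mono le_imp_power_dvd)
    next
      fix x assume "x \<in> {d. d dvd p ^ k * m}"
      then obtain u v where uv: "x = u * v" "u dvd p ^ k" "v dvd m"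
        by (auto elim: dvd_productE)
      then obtain i where "i \<le> k" "u = p ^ i"
        using p by (auto simp: divides_primepow_nat)
      then show "x \<in> (\<lambda>(i, d). p ^ i * d) ` ({..k} \<times> {d. d dvd m})"
        using uv by force
    qed
    from sum.reindex_bij_betw[OF this, of g] show ?thesis by (simp add: case_prod_unfold)
  qed
  finally show ?thesis by simp
qed

text \<open>The step for inductions over \<open>n\<close> that split off the full power of one
  prime; \<open>m < n\<close> makes the induction hypothesis applicable to the cofactor.\<close>

lemma prime_power_cofactorE:
  fixes n :: nat
  assumes "n > 1"
  obtains p k m where "prime p" "k > 0" "\<not> p dvd m" "n = p ^ k * m" "m < n" "m > 0"
proof -
  obtain p where p: "prime p" "p dvd n" using assms prime_factor_nat[of n] by auto
  define k where "k = multiplicity p n"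
  obtain m where m: "n = p ^ k * m" "\<not> p dvd m"
    unfolding k_def using multiplicity_decompose'[of n p] assms p by (metis less_numeral_extra(3) not_prime_unit not_one_less_zero)
  have "k > 0" unfolding k_def using p assms by (simp add: prime_multiplicity_gt_zero_iff)
  moreover have "m > 0" using m assms by (cases m) auto
  moreover have "p ^ k > 1" using p(1) \<open>k > 0\<close> by (intro one_less_power prime_gt_1_nat)
  ultimately show thesis using that[of p k m] p m by auto
qed

section \<open>The Moebius function\<close>

definition moebius_mu :: "nat \<Rightarrow> real" where
  "moebius_mu n = (if squarefree n then (-1) ^ card (prime_factors n) else 0)"

lemma abs_moebius_mu_le: "\<bar>moebius_mu n\<bar> \<le> 1"
  by (simp add: moebius_mu_def power_abs)

lemma moebius_mu_prime_power_mult: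
  assumes "prime p" "\<not> p dvd d" "d > 0"
  shows "moebius_mu (p ^ i * d) = (if i = 0 then 1 else if i = 1 then -1 else 0) * moebius_mu d"
proof -
  consider "i = 0" | "i = 1" | "i \<ge> 2" by linarith
  then show ?thesis
  proof cases
    case 2
    have "coprime p d" using assms by (simp add: prime_imp_coprime)
    then have "squarefree (p * d) \<longleftrightarrow> squarefree d"
      using assms by (auto simp: squarefree_mult_coprime squarefree_prime intro: squarefree_multD)
    moreover have "prime_factors (p * d) = insert p (prime_factors d)"
      using assms by (simp add: prime_factors_product prime_prime_factors)
    moreover have "p \<notin> prime_factors d" using assms by (auto simp: prime_factors_dvd)
    ultimately show ?thesis using 2 by (simp add: moebius_mu_def)
  next
    case 3
    have "p ^ 2 dvd p ^ i * d" using 3 by (simp add: le_imp_power_dvd)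
    then have "\<not> squarefree (p ^ i * d)"
      using assms(1) by (auto simp: squarefree_def prime_nat_iff)
    with 3 show ?thesis by (auto simp: moebius_mu_def)
  qed auto
qed

text \<open>Splitting off the full power of a prime \<open>p\<close> leaves the factor
  \<open>1 - 1 = 0\<close>, since only the exponents 0 and 1 of \<open>p\<close> contribute.\<close>

lemma sum_moebius_mu_divisors:
  assumes "n > 0"
  shows "(\<Sum>d | d dvd n. moebius_mu d) = (if n = 1 then 1 else 0)"
proof (cases "n = 1")
  case True
  then show ?thesis by (simp add: moebius_mu_def)
next
  case False
  with assms obtain p k m where *: "prime p" "k > 0" "\<not> p dvd m" "n = p ^ k * m" "m > 0"
    by (auto intro: prime_power_cofactorE[of n])
  have "(\<Sum>d | d dvd n. moebius_mu d)
     = (\<Sum>i\<le>k. if i = 0 then 1 else if i = 1 then -1 else 0) * (\<Sum>d | d dvd m. moebius_mu d)"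
    unfolding * by (rule sum_divisors_prime_power_mult[OF *(1) *(3)], rule moebius_mu_prime_power_mult)
      (use * in \<open>auto intro: Nat.gr0I dest: dvd_trans\<close>)
  also have "(\<Sum>i\<le>k. if i = 0 then 1 else if i = 1 then -1 else (0::real)) = (\<Sum>i\<in>{0,1::nat}. if i = 0 then 1 else if i = 1 then -1 else (0::real))"
    using \<open>k > 0\<close> by (intro sum.mono_neutral_right) auto
  finally show ?thesis using False by simp
qed

text \<open>Moebius inversion of \<open>\<Lambda> * 1 = log\<close>: expand \<open>log(n/d)\<close>
  as a sum of \<open>\<Lambda>(e)\<close> over \<open>e dvd n div d\<close> and exchange the sums.
  The inner sum of the Moebius function over the divisors of \<open>n div e\<close> then survives
  only for \<open>e = n\<close>.\<close>

lemma sum_moebius_mu_ln: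
  assumes "n > 0"
  shows "(\<Sum>d | d dvd n. moebius_mu d * ln (real n / real d)) = mangoldt n"
proof -
  have "(\<Sum>d | d dvd n. moebius_mu d * ln (real n / real d)) = (\<Sum>d | d dvd n. \<Sum>e | e dvd n div d. moebius_mu d * mangoldt e)"
  proof (intro sum.cong refl)
    fix d assume "d \<in> {d. d dvd n}"
    then have "n div d > 0" "real n / real d = real (n div d)" using assms
      by (auto simp: real_of_nat_div div_greater_zero_iff dvd_imp_le intro: Nat.gr0I)
    then show "moebius_mu d * ln (real n / real d) = (\<Sum>e | e dvd n div d. moebius_mu d * mangoldt e)"
      by (simp add: mangoldt_sum sum_distrib_left[symmetric])
  qed
  also have "\<dots> = (\<Sum>(d, e)\<in>(SIGMA d:{d. d dvd n}. {e. e dvd n div d}). moebius_mu d * mangoldt e)"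
    using assms by (subst sum.Sigma) (auto intro!: finite_divisors_nat elim!: dvdE)
  also have "(SIGMA d:{d. d dvd n}. {e. e dvd n div d}) = {(d, e). d * e dvd n}"
    using assms by (auto simp: dvd_div_iff_mult mult.commute dvd_mult_left dest: dvd_mult_left dvd_mult_right)
  also have "(\<Sum>(d, e)\<in>{(d, e). d * e dvd n}. moebius_mu d * mangoldt e)
     = (\<Sum>(e, d)\<in>(SIGMA e:{e. e dvd n}. {d. d dvd n div e}). moebius_mu d * mangoldt e)"
    using assms
    by (intro sum.reindex_bij_witness[of _ prod.swap prod.swap])
       (auto simp: dvd_div_iff_mult mult.commute dest: dvd_mult_left dvd_mult_right)
  also have "\<dots> = (\<Sum>e | e dvd n. \<Sum>d | d dvd n div e. moebius_mu d * mangoldt e)"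
    using assms by (subst sum.Sigma) (auto intro!: finite_divisors_nat elim!: dvdE)
  also have "\<dots> = (\<Sum>e | e dvd n. if e = n then mangoldt e else 0)"
  proof (intro sum.cong refl)
    fix e assume e: "e \<in> {e. e dvd n}"
    then have "n div e > 0" "n div e = 1 \<longleftrightarrow> e = n" using assms
      by (auto simp: div_greater_zero_iff dvd_imp_le intro: Nat.gr0I elim: dvdE)
    then show "(\<Sum>d | d dvd n div e. moebius_mu d * mangoldt e) = (if e = n then mangoldt e else 0)"
      by (simp add: sum_distrib_right[symmetric] sum_moebius_mu_divisors)
  qed
  also have "\<dots> = mangoldt n" using assms by simp
  finally show ?thesis .
qed

text \<open>Summation by parts: the decrements of \<open>b\<close> are nonnegative and telescope, so
  the bound \<open>B\<close> on the partial sums of \<open>c\<close> carries over with the factor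
  \<open>b 0\<close>.\<close>

lemma abel_bound:
  fixes c :: "nat \<Rightarrow> complex" and b :: "nat \<Rightarrow> real"
  assumes c: "\<And>k. norm (\<Sum>i<k. c i) \<le> B"
    and b: "\<And>i. b (Suc i) \<le> b i" "\<And>i. 0 \<le> b i"
  shows "norm (\<Sum>i<k. c i * of_real (b i)) \<le> B * b 0"
proof -
  define C where "C k = (\<Sum>i<k. c i)" for k
  have "(\<Sum>i<k. c i * of_real (b i)) = C k * of_real (b k) + (\<Sum>i<k. C (Suc i) * of_real (b i - b (Suc i)))"
    by (induction k) (auto simp: C_def algebra_simps)
  also have "norm \<dots> \<le> B * b k + (\<Sum>i<k. B * (b i - b (Suc i)))"
    using c b by (intro order.trans[OF norm_triangle_ineq] add_mono sum_norm_le)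
      (auto simp: norm_mult C_def simp del: of_real_diff sum.lessThan_Suc intro!: mult_right_mono)
  also have "\<dots> = B * b 0"
    by (simp only: sum_distrib_left[symmetric] sum_lessThan_telescope') (simp add: algebra_simps)
  finally show ?thesis .
qed

section \<open>Dirichlet characters\<close>

text \<open>Characters are total functions on the naturals instead of homomorphisms on a unit group,
  so equality of characters is equality of functions. The value 1 at 1 follows from multiplicativity
  and nonvanishing.\<close>

definition dchars :: "nat \<Rightarrow> (nat \<Rightarrow> complex) set" where
  "dchars q = {\<xi>. (\<forall>m n. \<xi> (m * n) = \<xi> m * \<xi> n) \<and> (\<forall>m n. [m = n] (mod q) \<longrightarrow> \<xi> m = \<xi> n)
                 \<and> (\<forall>n. \<xi> n \<noteq> 0 \<longleftrightarrow> coprime n q)}"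

definition principal_char :: "nat \<Rightarrow> nat \<Rightarrow> complex" where
  "principal_char q n = (if coprime n q then 1 else 0)"

lemma dcharsD:
  assumes "\<xi> \<in> dchars q"
  shows "\<xi> (m * n) = \<xi> m * \<xi> n" "[m = n] (mod q) \<Longrightarrow> \<xi> m = \<xi> n" "\<xi> n = 0 \<longleftrightarrow> \<not> coprime n q"
  using assms unfolding dchars_def by blast+

lemma coprime_cong_nat: "[m = n] (mod q) \<Longrightarrow> coprime m q \<longleftrightarrow> coprime n (q::nat)"
  using cong_imp_coprime cong_sym by blast

lemma principal_char_in_dchars: "principal_char q \<in> dchars q"
  unfolding dchars_def principal_char_def by (auto simp: coprime_cong_nat)

lemma dchars_mult: "\<xi> \<in> dchars q \<Longrightarrow> \<psi> \<in> dchars q \<Longrightarrow> (\<lambda>n. \<xi> n * \<psi> n) \<in> dchars q"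
  unfolding dchars_def by auto

lemma dchars_cnj: "\<xi> \<in> dchars q \<Longrightarrow> (\<lambda>n. cnj (\<xi> n)) \<in> dchars q"
  unfolding dchars_def by auto

lemma dchar_1 [simp]: "\<xi> \<in> dchars q \<Longrightarrow> \<xi> (Suc 0) = 1"
  using dcharsD(1)[of \<xi> q 1 1] dcharsD(3)[of \<xi> q 1] by simp

lemma dchar_power: "\<xi> \<in> dchars q \<Longrightarrow> \<xi> (n ^ k) = \<xi> n ^ k"
  by (induction k) (simp_all add: dcharsD(1))

lemma dchar_power_totient:
  assumes "\<xi> \<in> dchars q" "coprime n q"
  shows "\<xi> n ^ totient q = 1"
  using dcharsD(2)[OF assms(1) euler_theorem[OF assms(2)]] assms by (simp add: dchar_power)

lemma norm_dchar:
  assumes "\<xi> \<in> dchars q" "q > 0" "coprime n q"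
  shows "norm (\<xi> n) = 1"
proof -
  have "norm (\<xi> n) ^ totient q = 1"
    using dchar_power_totient[OF assms(1,3)] by (metis norm_one norm_power)
  then show ?thesis using assms power_eq_iff_eq_base[of "totient q" "norm (\<xi> n)" 1] by simp
qed

lemma norm_dchar_le_1: "\<xi> \<in> dchars q \<Longrightarrow> q > 0 \<Longrightarrow> norm (\<xi> n) \<le> 1"
  using norm_dchar[of \<xi> q n] dcharsD(3)[of \<xi> q n] by (cases "coprime n q") auto

text \<open>A character is determined by its values on \<open>{..<q}\<close>, and each of them is 0
  or a root of unity of order dividing \<open>totient q\<close>.\<close>

lemma finite_dchars:
  assumes "q > 0"
  shows "finite (dchars q)"
proof -
  define R where "R = insert 0 {z::complex. z ^ totient q = 1}"
  have "finite R" 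
    unfolding R_def using assms by (simp add: finite_nth_roots)
  have "inj_on (\<lambda>\<xi>. restrict \<xi> {..<q}) (dchars q)"
  proof (rule inj_onI, rule ext)
    fix \<xi> \<psi> n assume \<xi>: "\<xi> \<in> dchars q" and \<psi>: "\<psi> \<in> dchars q"
      and eq: "restrict \<xi> {..<q} = restrict \<psi> {..<q}"
    have "\<xi> (n mod q) = \<psi> (n mod q)"
      using fun_cong[OF eq, of "n mod q"] assms by simp
    then show "\<xi> n = \<psi> n"
      using dcharsD(2)[OF \<xi>, of n "n mod q"] dcharsD(2)[OF \<psi>, of n "n mod q"] by (simp add: cong_def)
  qed
  moreover have "(\<lambda>\<xi>. restrict \<xi> {..<q}) ` dchars q \<subseteq> {..<q} \<rightarrow>\<^sub>E R"
  proof (intro image_subsetI restrict_PiE_iff[THEN iffD2] ballI)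
    fix \<xi> n assume "\<xi> \<in> dchars q"
    then show "\<xi> n \<in> R"
      unfolding R_def using dchar_power_totient[of \<xi> q n] dcharsD(3)[of \<xi> q n] by blast
  qed
  moreover have "finite ({..<q} \<rightarrow>\<^sub>E R)"
    using \<open>finite R\<close> by (intro finite_PiE) auto
  ultimately show ?thesis by (meson finite_imageD finite_subset)
qed

lemma sum_periodic_shift:
  fixes f :: "nat \<Rightarrow> 'a::ab_group_add"
  assumes "\<And>n. f (n + q) = f n"
  shows "(\<Sum>i<q. f (m + i)) = (\<Sum>i<q. f i)"
proof (induction m)
  case (Suc m)
  have "f m + (\<Sum>i<q. f (m + Suc i)) = (\<Sum>i<Suc q. f (m + i))"
    by (subst sum.lessThan_Suc_shift) simp
  also have "\<dots> = (\<Sum>i<q. f (m + i)) + f m" by (simp add: assms)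
  finally show ?case using Suc by simp
qed simp

text \<open>Choose \<open>b\<close> prime to \<open>q\<close> with
  \<open>\<xi> b \<noteq> 1\<close>. Multiplication by \<open>b\<close> permutes the residues, so
  the sum over a period equals \<open>\<xi> b\<close> times itself.\<close>

lemma sum_dchar_period:
  assumes \<xi>: "\<xi> \<in> dchars q" and q: "q > 0" and np: "\<xi> \<noteq> principal_char q"
  shows "(\<Sum>i<q. \<xi> (m + i)) = 0"
proof -
  obtain b where "\<xi> b \<noteq> principal_char q b" using np by auto
  then have b: "coprime b q" "\<xi> b \<noteq> 1"
    using dcharsD(3)[OF \<xi>, of b] by (auto simp: principal_char_def split: if_splits)
  have inj: "inj_on (\<lambda>i. b * i mod q) {..<q}"
  proof (rule inj_onI)
    fix x y assume "x \<in> {..<q}" "y \<in> {..<q}" "b * x mod q = b * y mod q"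
    then have "[x = y] (mod q)" using cong_mult_lcancel_nat[OF b(1)] unfolding cong_def by blast
    then show "x = y" using \<open>x \<in> {..<q}\<close> \<open>y \<in> {..<q}\<close> by (simp add: cong_def)
  qed
  moreover have "(\<lambda>i. b * i mod q) ` {..<q} = {..<q}"
    by (rule endo_inj_surj[OF _ _ inj]) (use q in auto)
  ultimately have "bij_betw (\<lambda>i. b * i mod q) {..<q} {..<q}" by (simp add: bij_betw_def)
  then have "(\<Sum>i<q. \<xi> i) = (\<Sum>i<q. \<xi> (b * i mod q))"
    by (rule sum.reindex_bij_betw[symmetric])
  also have "\<dots> = (\<Sum>i<q. \<xi> b * \<xi> i)"
    by (intro sum.cong refl, subst dcharsD(1)[OF \<xi>, symmetric], rule dcharsD(2)[OF \<xi>]) simp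
  finally have "(\<Sum>i<q. \<xi> i) = \<xi> b * (\<Sum>i<q. \<xi> i)" unfolding sum_distrib_left .
  then have "(\<Sum>i<q. \<xi> i) = 0" using b(2) by simp
  moreover have "(\<Sum>i<q. \<xi> (m + i)) = (\<Sum>i<q. \<xi> i)"
    by (rule sum_periodic_shift, rule dcharsD(2)[OF \<xi>]) (simp add: cong_def)
  ultimately show ?thesis by simp
qed

text \<open>Complete periods cancel, which leaves fewer than \<open>q\<close> terms of modulus at
  most 1.\<close>

lemma norm_sum_dchar_le:
  assumes \<xi>: "\<xi> \<in> dchars q" and q: "q > 0" and np: "\<xi> \<noteq> principal_char q"
  shows "norm (\<Sum>i<k. \<xi> (m + i)) \<le> real q"
proof (induction k arbitrary: m rule: less_induct)
  case (less k)
  show ?case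
  proof (cases "k < q")
    case True
    have "norm (\<Sum>i<k. \<xi> (m + i)) \<le> (\<Sum>i<k. 1)"
      by (intro sum_norm_le norm_dchar_le_1[OF \<xi> q])
    with True show ?thesis by simp
  next
    case False
    then obtain j where k: "k = q + j" by (metis le_add_diff_inverse not_less)
    have "(\<Sum>i<q + j. \<xi> (m + i)) = (\<Sum>i<q. \<xi> (m + i)) + (\<Sum>i<j. \<xi> (m + q + i))"
      by (induction j) (simp_all add: add.assoc)
    with less[of j "m + q"] k q sum_dchar_period[OF assms] show ?thesis by simp
  qed
qed

section \<open>Extending characters from subgroups, and separation of residue classes\<close>

text \<open>A character of the subgroup \<open>H\<close> of \<open>(\<int>/q)\<^sup>\<times>\<close>; the subgroup is given as a union of residue classes.\<close>
definition partial_char :: "nat \<Rightarrow> nat set \<Rightarrow> (nat \<Rightarrow> complex) \<Rightarrow> bool" where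
  "partial_char q H \<psi> \<longleftrightarrow> 1 \<in> H \<and> (\<forall>x\<in>H. coprime x q \<and> \<psi> x \<noteq> 0)
     \<and> (\<forall>x\<in>H. \<forall>y\<in>H. x * y \<in> H \<and> \<psi> (x * y) = \<psi> x * \<psi> y)
     \<and> (\<forall>x\<in>H. \<forall>y. [x = y] (mod q) \<longrightarrow> y \<in> H \<and> \<psi> y = \<psi> x)"

lemma partial_charD:
  assumes "partial_char q H \<psi>"
  shows "1 \<in> H" "x \<in> H \<Longrightarrow> coprime x q" "x \<in> H \<Longrightarrow> \<psi> x \<noteq> 0"
    "x \<in> H \<Longrightarrow> y \<in> H \<Longrightarrow> x * y \<in> H" "x \<in> H \<Longrightarrow> y \<in> H \<Longrightarrow> \<psi> (x * y) = \<psi> x * \<psi> y"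
    "x \<in> H \<Longrightarrow> [x = y] (mod q) \<Longrightarrow> y \<in> H" "x \<in> H \<Longrightarrow> [x = y] (mod q) \<Longrightarrow> \<psi> y = \<psi> x"
  using assms unfolding partial_char_def by blast+

lemma partial_char_1:
  assumes "partial_char q H \<psi>"
  shows "\<psi> (Suc 0) = 1"
  using partial_charD(5)[OF assms, of 1 1] partial_charD(1,3)[OF assms] by simp

lemma partial_char_power:
  assumes "partial_char q H \<psi>" "x \<in> H"
  shows "x ^ k \<in> H \<and> \<psi> (x ^ k) = \<psi> x ^ k"
proof (induction k)
  case 0
  then show ?case using partial_charD(1)[OF assms(1)] partial_char_1[OF assms(1)] by simp
next
  case (Suc k)
  then show ?case using partial_charD(4,5)[OF assms(1) assms(2), of "x ^ k"] by simp
qed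

text \<open>By Euler's theorem \<open>h ^ (totient q - 1)\<close> inverts \<open>h\<close> modulo
  \<open>q\<close>, so closure under products already gives closure under division.\<close>

lemma partial_char_cancel:
  assumes "q > 0" "partial_char q H \<psi>" "h \<in> H" "h * y \<in> H"
  shows "y \<in> H"
proof -
  have "h ^ (totient q - 1) * (h * y) \<in> H"
    using assms partial_charD(4) partial_char_power by blast
  moreover have "h ^ (totient q - 1) * (h * y) = h ^ totient q * y"
    using assms(1) by (simp add: power_eq_if)
  moreover have "[h ^ totient q * y = 1 * y] (mod q)"
    using partial_charD(2)[OF assms(2,3)] by (intro cong_mult cong_refl euler_theorem)
  ultimately show ?thesis using partial_charD(6)[OF assms(2)] by (metis mult_1)
qed

text \<open>The number \<open>n\<close> is the order of \<open>g\<close> in the quotient of the unit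
  group by \<open>H\<close>.\<close>

lemma partial_char_order:
  assumes "q > 0" "partial_char q H \<psi>" "coprime g q"
  obtains n where "n > 0" "\<And>i. g ^ i \<in> H \<longleftrightarrow> n dvd i"
proof -
  define n where "n = (LEAST n. n > 0 \<and> g ^ n \<in> H)"
  have "[1 = g ^ totient q] (mod q)" using euler_theorem[OF assms(3)] by (rule cong_sym)
  then have "g ^ totient q \<in> H" using partial_charD(1,6)[OF assms(2)] by blast
  then have n: "n > 0 \<and> g ^ n \<in> H"
    unfolding n_def by (rule_tac LeastI[of _ "totient q"]) (use assms in auto)
  have "g ^ i \<in> H \<longleftrightarrow> n dvd i" for i
  proof
    assume "n dvd i"
    then show "g ^ i \<in> H" using n partial_char_power[OF assms(2)] by (auto simp: power_mult)
  next
    assume "g ^ i \<in> H"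
    moreover have "g ^ i = (g ^ n) ^ (i div n) * g ^ (i mod n)"
      by (metis mult_div_mod_eq power_add power_mult)
    ultimately have "g ^ (i mod n) \<in> H"
      using partial_char_cancel[OF assms(1,2)] partial_char_power[OF assms(2)] n by metis
    moreover have "i mod n < n" using n by simp
    ultimately have "i mod n = 0" using not_less_Least[of "i mod n" "\<lambda>n. n > 0 \<and> g ^ n \<in> H"]
      unfolding n_def[symmetric] by auto
    then show "n dvd i" by auto
  qed
  with n show thesis using that by blast
qed

text \<open>The group generated by \<open>H\<close> and \<open>g\<close> consists of the
  \<open>x\<close> with \<open>x * g ^ k \<in> H\<close> for some natural \<open>k\<close>; negative
  exponents can be avoided because \<open>g\<close> has finite order. On it the value at
  \<open>x\<close> has to be \<open>\<psi> (x * g ^ k) / w ^ k\<close>, and the condition on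
  \<open>w\<close> makes this independent of \<open>k\<close>.\<close>

lemma partial_char_adjoin:
  assumes q: "q > 0" and \<psi>: "partial_char q H \<psi>" and g: "coprime g q"
    and w: "w \<noteq> 0" "\<And>i. g ^ i \<in> H \<Longrightarrow> \<psi> (g ^ i) = w ^ i"
  obtains H' \<psi>' where "partial_char q H' \<psi>'" "insert g H \<subseteq> H'" "\<And>x. x \<in> H \<Longrightarrow> \<psi>' x = \<psi> x" "\<psi>' g = w"
proof -
  note D = partial_charD[OF \<psi>]
  define H' where "H' = {x. \<exists>k. x * g ^ k \<in> H}"
  define K where "K x = (SOME k. x * g ^ k \<in> H)" for x
  define \<psi>' where "\<psi>' x = \<psi> (x * g ^ K x) / w ^ K x" for x
  \<comment> \<open>Two admissible exponents differ by some \<open>i\<close> with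
    \<open>g ^ i \<in> H\<close>, and there \<open>w ^ i\<close> agrees with
    \<open>\<psi>\<close>.\<close>
  have wd: "\<psi> (x * g ^ j) / w ^ j = \<psi> (x * g ^ k) / w ^ k"
    if "x * g ^ k \<in> H" "x * g ^ j \<in> H" "k \<le> j" for x j k
  proof -
    have eq: "x * g ^ j = (x * g ^ k) * g ^ (j - k)" using that by (simp add: mult.assoc flip: power_add)
    then have in_H: "g ^ (j - k) \<in> H" using that partial_char_cancel[OF q \<psi>] by metis
    then have "\<psi> (x * g ^ j) = \<psi> (x * g ^ k) * w ^ (j - k)"
      unfolding eq using D(5) that w(2) by simp
    moreover have "w ^ j = w ^ k * w ^ (j - k)" using that by (simp flip: power_add)
    ultimately show ?thesis using w(1) by simp
  qed
  have \<psi>': "\<psi>' x = \<psi> (x * g ^ k) / w ^ k" if "x * g ^ k \<in> H" for x k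
  proof -
    have "x * g ^ K x \<in> H" unfolding K_def using that by (rule someI)
    then show ?thesis unfolding \<psi>'_def using wd that by (metis nle_le)
  qed
  have ext: "x \<in> H' \<and> \<psi>' x = \<psi> x" if "x \<in> H" for x
    using \<psi>'[of x 0] that unfolding H'_def by (auto intro: exI[of _ 0])
  have tot: "g ^ totient q \<in> H"
    using D(1,6) euler_theorem[OF g] cong_sym by blast
  have tot_eq: "g * g ^ (totient q - 1) = g ^ totient q" "w * w ^ (totient q - 1) = w ^ totient q"
    using q by (simp_all add: power_eq_if)
  have "g \<in> H'" unfolding H'_def using tot tot_eq by (auto intro: exI[of _ "totient q - 1"])
  moreover have "\<psi>' g = w"
  proof -
    have "\<psi>' g = (w * w ^ (totient q - 1)) / w ^ (totient q - 1)"
      using \<psi>'[of g "totient q - 1"] tot unfolding tot_eq by (simp add: w(2))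
    then show ?thesis using w(1) by simp
  qed
  moreover have "partial_char q H' \<psi>'"
    unfolding partial_char_def
  proof (intro conjI ballI allI impI)
    show "1 \<in> H'" using ext D(1) by blast
  next
    fix x assume "x \<in> H'"
    then obtain k where k: "x * g ^ k \<in> H" by (auto simp: H'_def)
    show "coprime x q" using D(2)[OF k] by simp
    show "\<psi>' x \<noteq> 0" using \<psi>'[OF k] D(3)[OF k] w by simp
    fix y
    {
      assume "y \<in> H'"
      then obtain j where j: "y * g ^ j \<in> H" by (auto simp: H'_def)
      have eq: "(x * y) * g ^ (k + j) = (x * g ^ k) * (y * g ^ j)" by (simp add: power_add algebra_simps)
      have in_H: "(x * y) * g ^ (k + j) \<in> H" unfolding eq by (rule D(4)[OF k j])
      then show "x * y \<in> H'" by (auto simp: H'_def)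
      show "\<psi>' (x * y) = \<psi>' x * \<psi>' y"
        unfolding \<psi>'[OF in_H] \<psi>'[OF k] \<psi>'[OF j] eq D(5)[OF k j] by (simp add: power_add)
    }
    {
      assume "[x = y] (mod q)"
      then have c: "[x * g ^ k = y * g ^ k] (mod q)" by (intro cong_mult cong_refl)
      then have in_H: "y * g ^ k \<in> H" using D(6) k by blast
      then show "y \<in> H'" by (auto simp: H'_def)
      show "\<psi>' y = \<psi>' x" unfolding \<psi>'[OF in_H] \<psi>'[OF k] D(7)[OF k c] ..
    }
  qed
  ultimately show thesis using that[of H' \<psi>'] ext by blast
qed

text \<open>Adjoin missing units one at a time. If \<open>g\<close> has order \<open>n\<close>
  modulo \<open>H\<close>, any \<open>n\<close>-th root of \<open>\<psi> (g ^ n)\<close> is an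
  admissible value at \<open>g\<close>, and such roots exist in the complex numbers.\<close>

lemma partial_char_extend:
  assumes "q > 0" "partial_char q H \<psi>"
  shows "\<exists>\<xi>\<in>dchars q. \<forall>x\<in>H. \<xi> x = \<psi> x"
  using assms(2)
proof (induction "card (totatives q - H)" arbitrary: H \<psi> rule: less_induct)
  case less
  note D = partial_charD[OF less.prems]
  show ?case
  proof (cases "\<forall>x. coprime x q \<longrightarrow> x \<in> H")
    case True
    define \<xi> where "\<xi> x = (if coprime x q then \<psi> x else 0)" for x
    have "\<xi> \<in> dchars q"
      unfolding dchars_def
    proof (intro CollectI conjI allI impI)
      show "\<xi> (m * n) = \<xi> m * \<xi> n" for m n
        using True D(5)[of m n] by (auto simp: \<xi>_def)
      show "\<xi> m = \<xi> n" if "[m = n] (mod q)" for m n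
        using True D(7)[of m n] that coprime_cong_nat[OF that] by (auto simp: \<xi>_def)
      show "\<xi> n \<noteq> 0 \<longleftrightarrow> coprime n q" for n
        using True D(3)[of n] by (auto simp: \<xi>_def)
    qed
    moreover have "\<forall>x\<in>H. \<xi> x = \<psi> x" using D(2) by (simp add: \<xi>_def)
    ultimately show ?thesis by blast
  next
    case False
    then obtain g where g: "coprime g q" "g \<notin> H" by blast
    obtain n where n: "n > 0" "\<And>i. g ^ i \<in> H \<longleftrightarrow> n dvd i"
      using partial_char_order[OF assms(1) less.prems g(1)] by blast
    have "\<psi> (g ^ n) \<noteq> 0" using n D(3) by simp
    then obtain w where w: "w ^ n = \<psi> (g ^ n)"
      using n(1) card_nth_roots[of "\<psi> (g ^ n)" n] by (metis (mono_tags) card.empty empty_Collect_eq less_irrefl)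
    have "w \<noteq> 0" using w \<open>\<psi> (g ^ n) \<noteq> 0\<close> n(1) by (metis zero_power)
    moreover have "\<psi> (g ^ i) = w ^ i" if "g ^ i \<in> H" for i
      using that n w partial_char_power[OF less.prems, of "g ^ n"] by (auto simp: power_mult elim!: dvdE)
    ultimately obtain H' \<psi>' where H': "partial_char q H' \<psi>'" "insert g H \<subseteq> H'" "\<And>x. x \<in> H \<Longrightarrow> \<psi>' x = \<psi> x"
      using partial_char_adjoin[OF assms(1) less.prems g(1)] by metis
    \<comment> \<open>The induction measure counts totatives, so \<open>g\<close> is replaced by its
      representative among them. For \<open>q = 1\<close> this is 1, not
      \<open>g mod q = 0\<close>.\<close>
    obtain h where h: "h \<in> totatives q" "[h = g] (mod q)"
    proof (cases "q = 1")
      case True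
      then show ?thesis using that[of 1] by simp
    next
      case False
      have "g mod q \<noteq> 0"
      proof
        assume "g mod q = 0"
        then have "q dvd g" by auto
        then have "is_unit q" using g(1) by (simp add: coprime_absorb_right)
        with False show "False" by simp
      qed
      then have "g mod q \<in> totatives q" using g assms(1) by (simp add: in_totatives_iff less_imp_le)
      then show ?thesis using that[of "g mod q"] by (simp add: cong_def)
    qed
    have "h \<notin> H" using D(6) h(2) g(2) by blast
    moreover have "h \<in> H'" using partial_charD(6)[OF H'(1)] H'(2) cong_sym[OF h(2)] by blast
    ultimately have "card (totatives q - H') < card (totatives q - H)"
      using H'(2) h(1) by (intro psubset_card_mono) auto
    from less.hyps[OF this H'(1)] obtain \<xi> where \<xi>: "\<xi> \<in> dchars q" "\<forall>x\<in>H'. \<xi> x = \<psi>' x" ..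
    have "\<xi> x = \<psi> x" if "x \<in> H" for x
      using \<xi>(2) H'(2) H'(3)[OF that] that by auto
    with \<xi>(1) show ?thesis by blast
  qed
qed

text \<open>Start from the trivial character on the class of 1. There \<open>a\<close> has order
  \<open>n > 1\<close>, so it may be sent to an \<open>n\<close>-th root of unity other than 1; then
  extend to all units.\<close>

lemma dchar_separates:
  assumes "q > 0" "coprime a q" "\<not> [a = 1] (mod q)"
  shows "\<exists>\<xi>\<in>dchars q. \<xi> a \<noteq> 1"
proof -
  define H where "H = {x. [x = 1] (mod q)}"
  have pc: "partial_char q H (\<lambda>_. 1)"
    unfolding partial_char_def H_def
    by (auto simp: coprime_cong_nat[of _ "Suc 0"] intro: cong_trans cong_sym) (use cong_mult in fastforce)
  obtain n where n: "n > 0" "\<And>i. a ^ i \<in> H \<longleftrightarrow> n dvd i"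
    using partial_char_order[OF assms(1) pc assms(2)] by blast
  have "n \<noteq> 1" using n(2)[of 1] assms(3) by (auto simp: H_def)
  have "\<not> {z::complex. z ^ n = 1} \<subseteq> {1}"
    using card_mono[of "{1::complex}" "{z. z ^ n = 1}"] card_roots_unity_eq[of n] n(1) \<open>n \<noteq> 1\<close> by auto
  then obtain w :: complex where w: "w ^ n = 1" "w \<noteq> 1" by blast
  have "w \<noteq> 0" using w n(1) by (auto simp: power_0_left)
  moreover have "1 = w ^ i" if "a ^ i \<in> H" for i
    using that n w by (auto simp: power_mult elim!: dvdE)
  ultimately obtain H' \<psi>' where H': "partial_char q H' \<psi>'" "insert a H \<subseteq> H'" "\<psi>' a = w"
    using partial_char_adjoin[OF assms(1) pc assms(2)] by metis
  then show ?thesis using partial_char_extend[OF assms(1) H'(1)] w(2) by (metis insert_subset)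
qed

text \<open>Multiplication by a character \<open>\<psi>\<close> with
  \<open>\<psi> a \<noteq> 1\<close> permutes the finite set of characters, so the sum equals
  \<open>\<psi> a\<close> times itself.\<close>

lemma sum_dchars_eq_0:
  assumes "q > 0" "coprime a q" "\<not> [a = 1] (mod q)"
  shows "(\<Sum>\<xi>\<in>dchars q. \<xi> a) = 0"
proof -
  obtain \<psi> where \<psi>: "\<psi> \<in> dchars q" "\<psi> a \<noteq> 1" using dchar_separates[OF assms] by blast
  have inj: "inj_on (\<lambda>\<xi> n. \<psi> n * \<xi> n) (dchars q)"
  proof (rule inj_onI, rule ext)
    fix \<xi> \<phi> n assume *: "\<xi> \<in> dchars q" "\<phi> \<in> dchars q" "(\<lambda>n. \<psi> n * \<xi> n) = (\<lambda>n. \<psi> n * \<phi> n)"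
    have "\<psi> n * \<xi> n = \<psi> n * \<phi> n" using fun_cong[OF *(3)] .
    then show "\<xi> n = \<phi> n"
      using dcharsD(3)[OF \<psi>(1), of n] dcharsD(3)[OF *(1), of n] dcharsD(3)[OF *(2), of n] by auto
  qed
  have "(\<lambda>\<xi> n. \<psi> n * \<xi> n) ` dchars q = dchars q"
    by (rule endo_inj_surj[OF finite_dchars[OF assms(1)] _ inj]) (auto intro: dchars_mult \<psi>)
  with sum.reindex[OF inj, of "\<lambda>\<xi>. \<xi> a"] have "(\<Sum>\<xi>\<in>dchars q. \<xi> a) = (\<Sum>\<xi>\<in>dchars q. \<psi> a * \<xi> a)"
    by (simp only: o_def)
  then have "(\<Sum>\<xi>\<in>dchars q. \<xi> a) = \<psi> a * (\<Sum>\<xi>\<in>dchars q. \<xi> a)" unfolding sum_distrib_left .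
  then show ?thesis using \<psi>(2) by simp
qed

lemma sum_dchars:
  assumes "q > 0"
  shows "(\<Sum>\<xi>\<in>dchars q. \<xi> n) = (if [n = 1] (mod q) then of_nat (card (dchars q)) else 0)"
proof (cases "[n = 1] (mod q)")
  case True
  then have "\<xi> n = 1" if "\<xi> \<in> dchars q" for \<xi>
    using dcharsD(2)[OF that] dchar_1[OF that] by (metis One_nat_def)
  then have "(\<Sum>\<xi>\<in>dchars q. \<xi> n) = (\<Sum>\<xi>\<in>dchars q. 1)" by (intro sum.cong) auto
  with True show ?thesis by simp
next
  case False
  then show ?thesis using sum_dchars_eq_0[OF assms _ False] dcharsD(3)
    by (cases "coprime n q") (auto intro!: sum.neutral)
qed

section \<open>Character sums twisted by the von Mangoldt function\<close>

text \<open>As \<open>\<xi> n / n\<close> is completely multiplicative, it factors over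
  \<open>n = d * m\<close>. It is applied with \<open>g = \<Lambda>\<close> and with the Moebius
  function times a logarithm.\<close>

lemma sum_dchar_divisors:
  assumes "\<xi> \<in> dchars q"
  shows "(\<Sum>n=1..N. \<xi> n * of_real (\<Sum>d | d dvd n. g d) / of_nat n)
       = (\<Sum>d=1..N. \<xi> d * of_real (g d) / of_nat d * (\<Sum>m=1..N div d. \<xi> m / of_nat m))"
proof -
  have "(\<Sum>n=1..N. \<xi> n * of_real (\<Sum>d | d dvd n. g d) / of_nat n)
      = (\<Sum>n=1..N. \<Sum>d | d dvd n. (\<xi> d * of_real (g d) / of_nat d) * (\<xi> (n div d) / of_nat (n div d)))"
  proof (intro sum.cong refl)
    fix n assume "n \<in> {1..N}"
    have "\<xi> n * of_real (\<Sum>d | d dvd n. g d) / of_nat n = (\<Sum>d | d dvd n. \<xi> n * of_real (g d) / of_nat n)"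
      by (simp add: sum_distrib_left sum_divide_distrib)
    also have "\<dots> = (\<Sum>d | d dvd n. (\<xi> d * of_real (g d) / of_nat d) * (\<xi> (n div d) / of_nat (n div d)))"
      by (intro sum.cong refl) (use \<open>n \<in> {1..N}\<close> in \<open>auto elim!: dvdE simp: dcharsD(1)[OF assms]\<close>)
    finally show "\<xi> n * of_real (\<Sum>d | d dvd n. g d) / of_nat n = \<dots>" .
  qed
  also have "\<dots> = (\<Sum>d=1..N. \<Sum>m=1..N div d. (\<xi> d * of_real (g d) / of_nat d) * (\<xi> m / of_nat m))"
    by (rule sum_divisors_swap)
  finally show ?thesis by (simp add: sum_distrib_left)
qed

lemma sum_dchar_ln:
  assumes "\<xi> \<in> dchars q"
  shows "(\<Sum>n=1..N. \<xi> n * of_real (ln (real n)) / of_nat n)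
       = (\<Sum>d=1..N. \<xi> d * of_real (mangoldt d) / of_nat d * (\<Sum>m=1..N div d. \<xi> m / of_nat m))"
proof -
  have "(\<Sum>n=1..N. \<xi> n * of_real (ln (real n)) / of_nat n)
      = (\<Sum>n=1..N. \<xi> n * of_real (\<Sum>d | d dvd n. mangoldt d) / of_nat n)"
    by (intro sum.cong refl) (subst mangoldt_sum, auto)
  then show ?thesis using sum_dchar_divisors[OF assms, of mangoldt N] by simp
qed

text \<open>The threshold 3 lies above \<open>e\<close>: there \<open>ln n \<ge> 1\<close>, while
  the logarithm grows by at most \<open>1/n\<close> from \<open>n\<close> to
  \<open>n + 1\<close>.\<close>

lemma ln_over_decreasing:
  assumes "n \<ge> 3"
  shows "ln (real (Suc n)) / real (Suc n) \<le> ln (real n) / real n"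
proof -
  have "exp 1 \<le> real n" using exp_le assms by linarith
  then have "1 \<le> ln (real n)" using assms by (subst ln_ge_iff) auto
  moreover have "ln (real (Suc n)) - ln (real n) \<le> 1 / real n"
    using ln_diff_le[of "real (Suc n)" "real n"] assms by simp
  then have "real n * (ln (real (Suc n)) - ln (real n)) \<le> 1"
    using assms by (simp add: field_simps)
  ultimately have "real n * ln (real (Suc n)) \<le> real (Suc n) * ln (real n)"
    by (simp add: algebra_simps)
  then show ?thesis using assms by (simp add: field_simps del: of_nat_Suc)
qed

definition L_partial :: "(nat \<Rightarrow> complex) \<Rightarrow> nat \<Rightarrow> complex" where
  "L_partial \<xi> N = (\<Sum>n=1..N. \<xi> n / of_nat n)"

text \<open>The operator \<open>lim\<close> is meaningful only for convergent sequences;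
  \<open>L_partial_tendsto\<close> identifies this value with \<open>L(1, \<xi>)\<close> for
  nonprincipal characters.\<close>

definition L_one :: "(nat \<Rightarrow> complex) \<Rightarrow> complex" where
  "L_one \<xi> = lim (L_partial \<xi>)"

definition mangoldt_partial :: "(nat \<Rightarrow> complex) \<Rightarrow> nat \<Rightarrow> complex" where
  "mangoldt_partial \<xi> N = (\<Sum>n=1..N. \<xi> n * of_real (mangoldt n) / of_nat n)"

section \<open>Estimates for a single nonprincipal character\<close>

locale nonprincipal_char =
  fixes q :: nat and \<xi> :: "nat \<Rightarrow> complex"
  assumes q_pos: "q > 0" and dchar: "\<xi> \<in> dchars q" and nonprincipal: "\<xi> \<noteq> principal_char q"
begin

lemma norm_sum_weighted_le:
  fixes b :: "nat \<Rightarrow> real"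
  assumes "\<And>n. n \<ge> m \<Longrightarrow> b (Suc n) \<le> b n" "\<And>n. n \<ge> m \<Longrightarrow> 0 \<le> b n"
  shows "norm (\<Sum>n=m..N. \<xi> n * of_real (b n)) \<le> real q * b m"
proof -
  have "(\<Sum>n=m..N. \<xi> n * of_real (b n)) = (\<Sum>i<Suc N - m. \<xi> (m + i) * of_real (b (m + i)))"
    unfolding atLeastLessThanSuc_atLeastAtMost[symmetric]
    by (subst sum.atLeastLessThan_shift_0) (auto simp: atLeast0LessThan)
  then show ?thesis
    using abel_bound[of "\<lambda>i. \<xi> (m + i)" "real q" "\<lambda>i. b (m + i)" "Suc N - m"]
      norm_sum_dchar_le[OF dchar q_pos nonprincipal] assms by simp
qed

lemma L_partial_diff:
  assumes "M \<le> N"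
  shows "norm (L_partial \<xi> N - L_partial \<xi> M) \<le> real q / real (Suc M)"
proof -
  have "{1..N} = {1..M} \<union> {Suc M..N}" using assms by auto
  then have "L_partial \<xi> N = L_partial \<xi> M + (\<Sum>n=Suc M..N. \<xi> n / of_nat n)"
    unfolding L_partial_def by (simp only:) (rule sum.union_disjoint, auto)
  moreover have "norm (\<Sum>n=Suc M..N. \<xi> n * of_real (1 / real n)) \<le> real q * (1 / real (Suc M))"
    by (rule norm_sum_weighted_le) (auto simp: field_simps)
  ultimately show ?thesis by simp
qed

lemma L_partial_tendsto: "L_partial \<xi> \<longlonglongrightarrow> L_one \<xi>"
proof -
  have "Cauchy (L_partial \<xi>)"
  proof (rule CauchyI')
    fix e :: real assume "e > 0"
    obtain M where M: "real q / e < real M" using reals_Archimedean2 by blast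
    show "\<exists>M. \<forall>m\<ge>M. \<forall>n>m. dist (L_partial \<xi> m) (L_partial \<xi> n) < e"
    proof (intro exI allI impI)
      fix m n assume mn: "m \<ge> M" "n > m"
      have "norm (L_partial \<xi> m - L_partial \<xi> n) \<le> real q / real (Suc m)"
        using L_partial_diff[of m n] mn by (simp add: norm_minus_commute)
      also have "\<dots> < e"
      proof -
        have "real q < e * real M" using M \<open>e > 0\<close> by (simp add: field_simps)
        also have "\<dots> \<le> e * real (Suc m)" using mn \<open>e > 0\<close> by (intro mult_left_mono) auto
        finally show ?thesis by (simp add: field_simps)
      qed
      finally show "dist (L_partial \<xi> m) (L_partial \<xi> n) < e" by (simp add: dist_norm)
    qed
  qed
  then show ?thesis unfolding L_one_def by (simp add: Cauchy_convergent convergent_LIMSEQ_iff[symmetric])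
qed

lemma L_tail: "norm (L_partial \<xi> M - L_one \<xi>) \<le> real q / real (Suc M)"
proof -
  have "norm (L_one \<xi> - L_partial \<xi> M) \<le> real q / real (Suc M)"
  proof (rule Lim_norm_ubound)
    show "(\<lambda>N. L_partial \<xi> N - L_partial \<xi> M) \<longlonglongrightarrow> L_one \<xi> - L_partial \<xi> M"
      by (intro tendsto_intros L_partial_tendsto)
    show "eventually (\<lambda>N. norm (L_partial \<xi> N - L_partial \<xi> M) \<le> real q / real (Suc M)) sequentially"
      using L_partial_diff by (auto simp: eventually_at_top_linorder)
  qed simp
  then show ?thesis by (simp add: norm_minus_commute)
qed

lemma L_tail_div:
  assumes "d > 0" "N > 0"
  shows "norm (L_partial \<xi> (N div d) - L_one \<xi>) \<le> real q * real d / real N"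
proof -
  have "N < d * Suc (N div d)" using dividend_less_times_div[of d N] assms by simp
  then have "real N \<le> real d * real (Suc (N div d))" by (metis less_imp_le of_nat_le_iff of_nat_mult)
  then have "real q / real (Suc (N div d)) \<le> real q * real d / real N"
    using assms mult_left_mono[of "real N" "real d * real (Suc (N div d))" "real q"]
    by (simp add: field_simps del: of_nat_Suc)
  then show ?thesis using L_tail[of "N div d"] by linarith
qed

text \<open>The factor \<open>d\<close> in the tail bound at \<open>N div d\<close> cancels the
  denominator \<open>d\<close>, so the estimate depends on \<open>d\<close> only through
  \<open>G\<close>.\<close>

lemma norm_summand_le:
  fixes g G :: real
  assumes "d > 0" "N > 0" "\<bar>g\<bar> \<le> G"
  shows "norm (\<xi> d * of_real g / of_nat d * (L_partial \<xi> (N div d) - L_one \<xi>)) \<le> G * (real q / real N)"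
proof -
  have "norm (\<xi> d) * \<bar>g\<bar> \<le> 1 * G"
    using assms norm_dchar_le_1[OF dchar q_pos] by (intro mult_mono) auto
  then have "norm (\<xi> d * of_real g / of_nat d) \<le> G / real d"
    by (simp add: norm_mult norm_divide divide_right_mono)
  then have "norm (\<xi> d * of_real g / of_nat d) * norm (L_partial \<xi> (N div d) - L_one \<xi>)
     \<le> G / real d * (real q * real d / real N)"
    using assms by (intro mult_mono L_tail_div) auto
  then show ?thesis using assms by (simp add: norm_mult norm_divide)
qed

text \<open>Summation by parts applies from \<open>n = 3\<close> on, where \<open>ln n / n\<close>
  decreases; the first two terms are bounded trivially.\<close>

lemma sum_ln_bounded: "\<exists>C. \<forall>N. norm (\<Sum>n=1..N. \<xi> n * of_real (ln (real n)) / of_nat n) \<le> C"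
proof (intro exI allI)
  fix N :: nat
  let ?f = "\<lambda>n. \<xi> n * of_real (ln (real n)) / of_nat n"
  have "{1..N} = {1..min 2 N} \<union> {3..N}" by auto
  then have "sum ?f {1..N} = sum ?f {1..min 2 N} + sum ?f {3..N}"
    by (simp only:) (rule sum.union_disjoint, auto)
  moreover have "norm (sum ?f {1..min 2 N}) \<le> (\<Sum>n=1..min 2 N. ln (real n))"
  proof (rule sum_norm_le)
    fix n assume n: "n \<in> {1..min 2 N}"
    have "norm (\<xi> n) * \<bar>ln (real n)\<bar> / real n \<le> 1 * ln (real n) / 1"
      using n norm_dchar_le_1[OF dchar q_pos, of n] by (intro frac_le mult_mono) auto
    then show "norm (?f n) \<le> ln (real n)" by (simp add: norm_mult norm_divide)
  qed
  moreover have "(\<Sum>n=1..min 2 N. ln (real n)) \<le> (\<Sum>n=1..2. ln (real n))"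
    by (rule sum_mono2) auto
  moreover have "norm (\<Sum>n=3..N. \<xi> n * of_real (ln (real n) / real n)) \<le> real q * (ln (real 3) / real 3)"
    by (rule norm_sum_weighted_le) (use ln_over_decreasing in auto)
  ultimately show "norm (sum ?f {1..N}) \<le> (\<Sum>n=1..2. ln (real n)) + real q * (ln (real 3) / real 3)"
    using norm_triangle_ineq[of "sum ?f {1..min 2 N}" "sum ?f {3..N}"] by simp
qed

text \<open>In the identity for the sum of \<open>\<xi>(n) log n / n\<close>, replace each inner
  partial sum by \<open>L_one \<xi>\<close>. The total error is at most
  \<open>q * psi N / N \<le> 6 q\<close>, and dividing by \<open>L_one \<xi>\<close> gives the
  bound.\<close>

lemma mangoldt_partial_bounded:
  assumes "L_one \<xi> \<noteq> 0"
  shows "\<exists>C. \<forall>N. norm (mangoldt_partial \<xi> N) \<le> C"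
proof -
  obtain C where C: "\<And>N. norm (\<Sum>n=1..N. \<xi> n * of_real (ln (real n)) / of_nat n) \<le> C"
    using sum_ln_bounded by blast
  have "norm (mangoldt_partial \<xi> N) \<le> (C + 6 * real q) / norm (L_one \<xi>)" for N
  proof (cases "N = 0")
    case True
    have "C \<ge> 0" using C[of 0] by simp
    with True show ?thesis by (simp add: mangoldt_partial_def)
  next
    case False
    have "(\<Sum>n=1..N. \<xi> n * of_real (ln (real n)) / of_nat n) - L_one \<xi> * mangoldt_partial \<xi> N
       = (\<Sum>d=1..N. \<xi> d * of_real (mangoldt d) / of_nat d * (L_partial \<xi> (N div d) - L_one \<xi>))"
      unfolding sum_dchar_ln[OF dchar] mangoldt_partial_def L_partial_def[of \<xi>, symmetric]
      unfolding right_diff_distrib sum_subtractf sum_distrib_left by (simp add: mult.commute)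
    also have "norm \<dots> \<le> (\<Sum>d=1..N. mangoldt d * (real q / real N))"
    proof (rule sum_norm_le)
      fix d assume d: "d \<in> {1..N}"
      show "norm (\<xi> d * of_real (mangoldt d) / of_nat d * (L_partial \<xi> (N div d) - L_one \<xi>)) \<le> mangoldt d * (real q / real N)"
        using d False by (intro norm_summand_le) auto
    qed
    also have "\<dots> = psi N * real q / real N" by (simp add: psi_def sum_distrib_right sum_divide_distrib)
    also have "\<dots> \<le> 6 * real N * real q / real N" using psi_le[of N] by (intro divide_right_mono mult_right_mono) auto
    also have "\<dots> = 6 * real q" using False by simp
    finally have "norm (L_one \<xi> * mangoldt_partial \<xi> N) \<le> C + 6 * real q"
      using C[of N] norm_triangle_ineq2[of "L_one \<xi> * mangoldt_partial \<xi> N" "\<Sum>n=1..N. \<xi> n * of_real (ln (real n)) / of_nat n"]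
      by (simp add: norm_minus_commute)
    then show ?thesis using assms by (simp add: norm_mult field_simps)
  qed
  then show ?thesis by blast
qed

text \<open>With \<open>L_one \<xi> = 0\<close> every inner partial sum is its own tail, so the sum
  twisted by \<open>g\<close> is at most \<open>q / N\<close> times the sum of
  \<open>log(N/d)\<close>. The latter is at most \<open>N\<close> by the Stirling bound.\<close>

lemma mangoldt_partial_if_L_one_zero:
  assumes "L_one \<xi> = 0" "N > 0"
  shows "norm (mangoldt_partial \<xi> N + of_real (ln (real N))) \<le> real q"
proof -
  define g where "g d = moebius_mu d * ln (real N / real d)" for d
  have "mangoldt_partial \<xi> N + of_real (ln (real N)) = (\<Sum>n=1..N. \<xi> n * of_real (\<Sum>d | d dvd n. g d) / of_nat n)"
  proof -
    \<comment> \<open>Split \<open>log(N/d) = log(n/d) + log(N/n)\<close>: the first part gives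
      \<open>\<Lambda>(n)\<close>, the second survives only at \<open>n = 1\<close>.\<close>
    have "(\<Sum>d | d dvd n. g d) = mangoldt n + (if n = 1 then ln (real N) else 0)" if "n \<in> {1..N}" for n
    proof -
      have "(\<Sum>d | d dvd n. g d) = (\<Sum>d | d dvd n. moebius_mu d * ln (real n / real d) + ln (real N / real n) * moebius_mu d)"
        unfolding g_def using that
        by (intro sum.cong refl) (auto simp: ln_div algebra_simps elim!: dvdE)
      also have "\<dots> = mangoldt n + ln (real N / real n) * (if n = 1 then 1 else 0)"
        using that by (simp add: sum.distrib sum_moebius_mu_ln sum_moebius_mu_divisors flip: sum_distrib_left)
      finally show ?thesis by simp
    qed
    then have "(\<Sum>n=1..N. \<xi> n * of_real (\<Sum>d | d dvd n. g d) / of_nat n)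
       = (\<Sum>n=1..N. \<xi> n * of_real (mangoldt n) / of_nat n + (if n = 1 then of_real (ln (real N)) else 0))"
      using dchar by (intro sum.cong refl) auto
    also have "\<dots> = mangoldt_partial \<xi> N + of_real (ln (real N))"
      using assms(2) by (simp add: sum.distrib mangoldt_partial_def)
    finally show ?thesis by simp
  qed
  also have "\<dots> = (\<Sum>d=1..N. \<xi> d * of_real (g d) / of_nat d * (L_partial \<xi> (N div d) - L_one \<xi>))"
    unfolding sum_dchar_divisors[OF dchar] L_partial_def[of \<xi>, symmetric] assms by simp
  also have "norm \<dots> \<le> (\<Sum>d=1..N. ln (real N / real d) * (real q / real N))"
  proof (rule sum_norm_le)
    fix d assume d: "d \<in> {1..N}"
    then have ln: "ln (real N / real d) \<ge> 0" by (intro ln_ge_zero) auto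
    have "\<bar>g d\<bar> \<le> 1 * ln (real N / real d)"
      unfolding g_def abs_mult using ln abs_moebius_mu_le[of d] by (intro mult_mono) auto
    then show "norm (\<xi> d * of_real (g d) / of_nat d * (L_partial \<xi> (N div d) - L_one \<xi>)) \<le> ln (real N / real d) * (real q / real N)"
      using d assms(2) by (intro norm_summand_le) auto
  qed
  also have "\<dots> = (\<Sum>d=1..N. ln (real N) - ln (real d)) * (real q / real N)"
    unfolding sum_distrib_right using assms(2) by (intro sum.cong refl) (simp add: ln_div)
  also have "\<dots> = (real N * ln (real N) - ln (fact N)) * (real q / real N)"
    by (simp add: sum_subtractf ln_fact_eq_sum_ln)
  also have "\<dots> \<le> real N * (real q / real N)"
    using ln_fact_ge[of N] by (intro mult_right_mono) auto
  also have "\<dots> = real q" using assms(2) by simp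
  finally show ?thesis .
qed

end

text \<open>The upper half of Mertens' estimate: replacing \<open>N/n\<close> by its integer part
  costs at most \<open>psi N \<le> 6 N\<close>, and what remains is \<open>log N!\<close>.\<close>

lemma sum_mangoldt_over_le:
  assumes "N > 0"
  shows "(\<Sum>n=1..N. mangoldt n / real n) \<le> ln (real N) + 6"
proof -
  have "real N * (\<Sum>n=1..N. mangoldt n / real n) \<le> (\<Sum>n=1..N. mangoldt n * real (N div n) + mangoldt n)"
    unfolding sum_distrib_left
  proof (rule sum_mono)
    fix n assume n: "n \<in> {1..N}"
    have "N < n * Suc (N div n)" using dividend_less_times_div[of n N] n by simp
    then have "real N \<le> real n * (real (N div n) + 1)"
      by (metis less_imp_le of_nat_Suc of_nat_le_iff of_nat_mult add.commute)
    then have "real N / real n \<le> real (N div n) + 1" using n by (simp add: field_simps)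
    then have "mangoldt n * (real N / real n) \<le> mangoldt n * (real (N div n) + 1)"
      by (intro mult_left_mono mangoldt_nonneg)
    then show "real N * (mangoldt n / real n) \<le> mangoldt n * real (N div n) + mangoldt n"
      by (simp add: algebra_simps)
  qed
  also have "\<dots> = ln (fact N) + psi N" by (simp add: sum.distrib ln_fact_eq_sum_mangoldt psi_def)
  also have "\<dots> \<le> real N * (ln (real N) + 6)" using ln_fact_le[of N] psi_le[of N] by (simp add: algebra_simps)
  finally show ?thesis using assms by simp
qed

section \<open>Real characters\<close>

text \<open>These are the divisor sums of a real character at the prime power \<open>p ^ k\<close>,
  with \<open>r\<close> its value at \<open>p\<close>.\<close>

lemma sum_powers_sign:
  fixes r :: real
  assumes "r \<in> {-1, 0, 1}"
  shows "0 \<le> (\<Sum>i\<le>k. r ^ i)" "even k \<Longrightarrow> 1 \<le> (\<Sum>i\<le>k. r ^ i)"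
proof -
  have minus: "(\<Sum>i\<le>k. (- 1) ^ i) = (if even k then 1 else (0::real))"
    by (induction k) auto
  have zero: "(\<Sum>i\<le>k. 0 ^ i) = (1::real)"
    by (induction k) auto
  show "0 \<le> (\<Sum>i\<le>k. r ^ i)" "even k \<Longrightarrow> 1 \<le> (\<Sum>i\<le>k. r ^ i)"
    using assms minus zero by auto
qed

text \<open>Pair the exponents \<open>i\<close> and \<open>n - 1 - i\<close> and apply the
  inequality of arithmetic and geometric means to each pair.\<close>

lemma sum_even_powers_ge:
  fixes s :: real
  assumes "0 \<le> s"
  shows "real n * s ^ (n - 1) \<le> (\<Sum>i<n. (s ^ 2) ^ i)"
proof -
  have "(\<Sum>i<n. 2 * s ^ (n - 1)) \<le> (\<Sum>i<n. (s ^ 2) ^ i + (s ^ 2) ^ (n - Suc i))"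
  proof (rule sum_mono)
    fix i assume "i \<in> {..<n}"
    then have "s ^ (n - 1) = s ^ i * s ^ (n - Suc i)" by (simp flip: power_add)
    moreover have "0 \<le> (s ^ i - s ^ (n - Suc i)) ^ 2" by simp
    ultimately show "2 * s ^ (n - 1) \<le> (s ^ 2) ^ i + (s ^ 2) ^ (n - Suc i)"
      by (simp add: power2_eq_square power_mult_distrib algebra_simps)
  qed
  also have "\<dots> = 2 * (\<Sum>i<n. (s ^ 2) ^ i)"
    using sum.nat_diff_reindex[of "\<lambda>i. (s ^ 2) ^ i" n] by (simp add: sum.distrib)
  finally show ?thesis by simp
qed

text \<open>With \<open>s = sqrt t\<close> the previous estimate on both factors yields
  \<open>n (n + 1) s ^ (2n - 1)\<close>, and
  \<open>s ^ (2n - 1) \<ge> s ^ (2n) = t ^ n\<close>.\<close>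

lemma geometric_product_ge:
  fixes t :: real
  assumes "0 < t" "t < 1" "n > 0"
  shows "real n * real (Suc n) * t ^ n \<le> (\<Sum>i<n. t ^ i) * (\<Sum>i<Suc n. t ^ i)"
proof -
  define s where "s = sqrt t"
  have s: "0 < s" "s < 1" "t = s ^ 2" using assms by (auto simp: s_def)
  have "t ^ n = s ^ (n + n)" unfolding s by (simp add: power_mult[symmetric] mult_2)
  also have "\<dots> \<le> s ^ ((n - 1) + n)" using s by (intro power_decreasing) auto
  also have "\<dots> = s ^ (n - 1) * s ^ n" by (rule power_add)
  finally have "real n * real (Suc n) * t ^ n \<le> real n * real (Suc n) * (s ^ (n - 1) * s ^ n)"
    by (intro mult_left_mono) auto
  also have "\<dots> = (real n * s ^ (n - 1)) * (real (Suc n) * s ^ (Suc n - 1))" by simp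
  also have "\<dots> \<le> (\<Sum>i<n. (s ^ 2) ^ i) * (\<Sum>i<Suc n. (s ^ 2) ^ i)"
    using s by (intro mult_mono sum_even_powers_ge) (auto intro!: sum_nonneg)
  finally show ?thesis using s by simp
qed

text \<open>The Lambert term subtracted from its leading part as \<open>t\<close> tends to 1. Summed
  against \<open>\<xi>\<close>, that leading part gives
  \<open>L(1, \<xi>) / (1 - t)\<close>.\<close>

definition lambert_weight :: "real \<Rightarrow> nat \<Rightarrow> real" where
  "lambert_weight t n = 1 / (real n * (1 - t)) - t ^ n / (1 - t ^ n)"

lemma lambert_weight_eq:
  assumes "0 < t" "t < 1"
  shows "lambert_weight t n = (1 / real n - t ^ n / (\<Sum>i<n. t ^ i)) / (1 - t)"
proof -
  have "1 - t ^ n = (1 - t) * (\<Sum>i<n. t ^ i)" by (rule one_diff_power_eq)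
  then show ?thesis unfolding lambert_weight_def by (simp add: diff_divide_distrib mult.commute)
qed

lemma lambert_weight_nonneg:
  assumes "0 < t" "t < 1" "n > 0"
  shows "0 \<le> lambert_weight t n"
proof -
  have "(\<Sum>i<n. t ^ n) \<le> (\<Sum>i<n. t ^ i)"
    using assms by (intro sum_mono power_decreasing) auto
  then have "real n * t ^ n \<le> (\<Sum>i<n. t ^ i)" by simp
  moreover have "0 < (\<Sum>i<n. t ^ i)" using assms by (intro sum_pos) auto
  ultimately have "t ^ n / (\<Sum>i<n. t ^ i) \<le> 1 / real n" using assms by (simp add: field_simps)
  then show ?thesis unfolding lambert_weight_eq[OF assms(1,2)] using assms by simp
qed

text \<open>With \<open>G\<close> the geometric sums, \<open>t ^ n / G n\<close> drops by
  \<open>t ^ n / (G n * G (Suc n))\<close> from \<open>n\<close> to \<open>n + 1\<close>. By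
  \<open>geometric_product_ge\<close> this is at most \<open>1 / (n (n + 1))\<close>, the drop of
  \<open>1 / n\<close>.\<close>

lemma lambert_weight_decreasing:
  assumes "0 < t" "t < 1" "n > 0"
  shows "lambert_weight t (Suc n) \<le> lambert_weight t n"
proof -
  define G where "G k = (\<Sum>i<k. t ^ i)" for k
  have pos: "0 < G n" "0 < G (Suc n)" unfolding G_def using assms by (auto intro!: sum_pos simp del: sum.lessThan_Suc)
  have G: "G (Suc n) = 1 + t * G n"
    unfolding G_def by (subst sum.lessThan_Suc_shift) (simp add: sum_distrib_left)
  have "t ^ n / G n - t ^ Suc n / G (Suc n) = t ^ n * (G (Suc n) - t * G n) / (G n * G (Suc n))"
    using pos by (simp add: field_simps)
  also have "\<dots> = t ^ n / (G n * G (Suc n))" by (simp add: G)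
  also have "\<dots> \<le> 1 / (real n * real (Suc n))"
    using geometric_product_ge[OF assms] pos assms unfolding G_def[symmetric]
    by (simp add: field_simps del: of_nat_Suc)
  also have "\<dots> = 1 / real n - 1 / real (Suc n)" using assms by (simp add: field_simps)
  finally have "1 / real (Suc n) - t ^ Suc n / G (Suc n) \<le> 1 / real n - t ^ n / G n" by simp
  then show ?thesis unfolding lambert_weight_eq[OF assms(1,2)] G_def[symmetric]
    using assms by (intro divide_right_mono) auto
qed

lemma sum_geometric_multiples:
  fixes t :: real
  assumes "0 < t" "t < 1" "d > 0"
  shows "(\<Sum>k=1..K. t ^ (d * k)) = t ^ d / (1 - t ^ d) - t ^ (d * Suc K) / (1 - t ^ d)"
proof -
  have "t ^ d < 1" using assms by (simp add: power_less_one_iff)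
  moreover have "(1 - t ^ d) * (\<Sum>k=1..K. t ^ (d * k)) = t ^ d - t ^ (d * Suc K)"
  proof (induction K)
    case (Suc K)
    have "(1 - t ^ d) * (\<Sum>k=1..Suc K. t ^ (d * k))
        = (1 - t ^ d) * (\<Sum>k=1..K. t ^ (d * k)) + (1 - t ^ d) * t ^ (d * Suc K)"
      by (simp add: distrib_left)
    also have "\<dots> = t ^ d - t ^ (d * Suc (Suc K))"
      unfolding Suc.IH by (simp add: algebra_simps power_add)
    finally show ?case .
  qed simp
  ultimately show ?thesis by (simp add: diff_divide_distrib[symmetric] eq_divide_eq mult.commute)
qed

section \<open>Monsky's argument for real characters\<close>

context nonprincipal_char
begin

lemma Re_dchar_cases:
  assumes "\<xi> n \<in> \<real>"
  shows "Re (\<xi> n) \<in> {-1, 0, 1}"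
proof (cases "coprime n q")
  case True
  then have "norm (\<xi> n) = 1" by (rule norm_dchar[OF dchar q_pos])
  with assms show ?thesis by (auto simp: complex_is_Real_iff cmod_eq_Re)
next
  case False
  then show ?thesis using dcharsD(3)[OF dchar, of n] by simp
qed

text \<open>The divisor sum is a product over the prime powers exactly dividing \<open>n\<close> of
  nonnegative factors. For a square all exponents are even, and every factor is at least 1.\<close>

lemma divisor_sum_real:
  assumes real: "\<And>n. \<xi> n \<in> \<real>" and "n > 0"
  shows "0 \<le> (\<Sum>d | d dvd n. Re (\<xi> d)) \<and> 1 \<le> (\<Sum>d | d dvd n ^ 2. Re (\<xi> d))"
  using \<open>n > 0\<close>
proof (induction n rule: less_induct)
  case (less n)
  have Re_mult: "Re (\<xi> (a * b)) = Re (\<xi> a) * Re (\<xi> b)" for a b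
    using real[of a] real[of b] by (simp add: dcharsD(1)[OF dchar] complex_is_Real_iff)
  have Re_power: "Re (\<xi> (a ^ k)) = Re (\<xi> a) ^ k" for a k
    by (induction k) (use Re_mult dchar in auto)
  have factor: "(\<Sum>d | d dvd p ^ k * m. Re (\<xi> d)) = (\<Sum>i\<le>k. Re (\<xi> p) ^ i) * (\<Sum>d | d dvd m. Re (\<xi> d))"
    if "prime p" "\<not> p dvd m" for p k m
    using that by (intro sum_divisors_prime_power_mult) (simp_all add: Re_mult Re_power)
  show ?case
  proof (cases "n = 1")
    case True
    then show ?thesis using dchar by simp
  next
    case False
    with less.prems have "n > 1" by simp
    then obtain p k m where n: "prime p" "k > 0" "\<not> p dvd m" "n = p ^ k * m" "m < n" "m > 0"
      by (rule prime_power_cofactorE)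
    have IH: "0 \<le> (\<Sum>d | d dvd m. Re (\<xi> d))" "1 \<le> (\<Sum>d | d dvd m ^ 2. Re (\<xi> d))"
      using less.IH[OF n(5,6)] by auto
    note sign = sum_powers_sign[OF Re_dchar_cases[OF real]]
    have "0 \<le> (\<Sum>d | d dvd n. Re (\<xi> d))"
      unfolding n(4) factor[OF n(1,3)] using IH(1) sign(1) by simp
    moreover have "n ^ 2 = p ^ (2 * k) * m ^ 2"
      unfolding n(4) by (simp add: power_mult_distrib power_mult[symmetric] mult.commute)
    moreover have "\<not> p dvd m ^ 2" using n(1,3) prime_dvd_power by blast
    then have "(\<Sum>d | d dvd p ^ (2 * k) * m ^ 2. Re (\<xi> d))
       = (\<Sum>i\<le>2 * k. Re (\<xi> p) ^ i) * (\<Sum>d | d dvd m ^ 2. Re (\<xi> d))"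
      by (rule factor[OF n(1)])
    moreover have "1 * 1 \<le> (\<Sum>i\<le>2 * k. Re (\<xi> p) ^ i) * (\<Sum>d | d dvd m ^ 2. Re (\<xi> d))"
      using IH(2) sign(2)[of "2 * k" p] by (intro mult_mono) auto
    ultimately show ?thesis by simp
  qed
qed

text \<open>The truncated sum is rewritten as a truncated Lambert series. Its leading part tends to
  \<open>L(1, \<xi>) / (1 - t) = 0\<close>, the weighted part is at most \<open>q\<close> by
  summation by parts, and the truncation error vanishes in the limit.\<close>

lemma lambert_bound:
  assumes real: "\<And>n. \<xi> n \<in> \<real>" and "L_one \<xi> = 0" and t: "0 < t" "t < 1"
  shows "(\<Sum>m=1..M. (\<Sum>d | d dvd m. Re (\<xi> d)) * t ^ m) \<le> real q"
proof -
  define F where "F M = (\<Sum>m=1..M. (\<Sum>d | d dvd m. Re (\<xi> d)) * t ^ m)" for M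
  have F_le: "F M \<le> norm (L_partial \<xi> M) / (1 - t) + real q + real M * t ^ M / (1 - t)" for M
  proof -
    \<comment> \<open>\<open>E\<close> collects the tails of the geometric series in the multiples
      of \<open>d\<close>, cut off at \<open>M\<close>.\<close>
    define E where "E = (\<Sum>d=1..M. Re (\<xi> d) * (t ^ (d * Suc (M div d)) / (1 - t ^ d)))"
    have "F M = (\<Sum>m=1..M. \<Sum>d | d dvd m. Re (\<xi> d) * t ^ (d * (m div d)))"
      unfolding F_def sum_distrib_right by (intro sum.cong refl) auto
    also have "\<dots> = (\<Sum>d=1..M. \<Sum>k=1..M div d. Re (\<xi> d) * t ^ (d * k))"
      by (rule sum_divisors_swap)
    also have "\<dots> = (\<Sum>d=1..M. Re (\<xi> d) * (t ^ d / (1 - t ^ d) - t ^ (d * Suc (M div d)) / (1 - t ^ d)))"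
      unfolding sum_distrib_left[symmetric]
      by (intro sum.cong refl arg_cong2[where f = "(*)"] sum_geometric_multiples t) auto
    also have "\<dots> = (\<Sum>d=1..M. Re (\<xi> d) / real d / (1 - t) - Re (\<xi> d) * lambert_weight t d) - E"
      unfolding E_def sum_subtractf[symmetric]
      by (intro sum.cong refl) (simp add: lambert_weight_def right_diff_distrib)
    also have "\<dots> = Re (L_partial \<xi> M) / (1 - t) - Re (\<Sum>d=1..M. \<xi> d * of_real (lambert_weight t d)) - E"
      by (simp add: sum_subtractf L_partial_def sum_divide_distrib)
    finally have "F M = Re (L_partial \<xi> M) / (1 - t) - Re (\<Sum>d=1..M. \<xi> d * of_real (lambert_weight t d)) - E" .
    moreover have "norm (\<Sum>d=1..M. \<xi> d * of_real (lambert_weight t d)) \<le> real q * lambert_weight t 1"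
      by (rule norm_sum_weighted_le) (use t in \<open>auto intro: lambert_weight_decreasing lambert_weight_nonneg\<close>)
    \<comment> \<open>Thus the bound on the weighted sum does not depend on
      \<open>t\<close>.\<close>
    moreover have "lambert_weight t 1 = 1" using t by (simp add: lambert_weight_def flip: diff_divide_distrib)
    moreover have "\<bar>E\<bar> \<le> (\<Sum>d=1..M. t ^ M / (1 - t))"
      unfolding E_def
    proof (rule order.trans[OF sum_abs], rule sum_mono)
      fix d assume d: "d \<in> {1..M}"
      have "M \<le> d * Suc (M div d)" using dividend_less_times_div[of d M] d by simp
      then have "t ^ (d * Suc (M div d)) \<le> t ^ M" using t by (intro power_decreasing) auto
      moreover have "t ^ d \<le> t ^ 1" using t d by (intro power_decreasing) auto
      ultimately have "t ^ (d * Suc (M div d)) / (1 - t ^ d) \<le> t ^ M / (1 - t)"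
        using t by (intro frac_le) auto
      moreover have "0 \<le> t ^ (d * Suc (M div d)) / (1 - t ^ d)"
        using t by (intro divide_nonneg_nonneg) (auto simp: power_le_one)
      moreover have "\<bar>Re (\<xi> d)\<bar> \<le> 1" using Re_dchar_cases[OF real, of d] by auto
      ultimately have "\<bar>Re (\<xi> d)\<bar> * (t ^ (d * Suc (M div d)) / (1 - t ^ d)) \<le> 1 * (t ^ M / (1 - t))"
        by (intro mult_mono) auto
      then show "\<bar>Re (\<xi> d) * (t ^ (d * Suc (M div d)) / (1 - t ^ d))\<bar> \<le> t ^ M / (1 - t)"
        using \<open>0 \<le> t ^ (d * Suc (M div d)) / (1 - t ^ d)\<close> by (simp only: abs_mult abs_of_nonneg mult_1)
    qed
    moreover have "Re (L_partial \<xi> M) / (1 - t) \<le> norm (L_partial \<xi> M) / (1 - t)"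
      using t complex_Re_le_cmod by (intro divide_right_mono) auto
    ultimately show ?thesis
      using abs_Re_le_cmod[of "\<Sum>d=1..M. \<xi> d * of_real (lambert_weight t d)"] by auto
  qed
  have "(\<lambda>M. norm (L_partial \<xi> M) / (1 - t) + real q + real M * t ^ M / (1 - t))
      \<longlonglongrightarrow> norm (L_one \<xi>) / (1 - t) + real q + 0 / (1 - t)"
    using t by (intro tendsto_intros L_partial_tendsto powser_times_n_limit_0) auto
  then have "(\<lambda>M. norm (L_partial \<xi> M) / (1 - t) + real q + real M * t ^ M / (1 - t)) \<longlonglongrightarrow> real q"
    using \<open>L_one \<xi> = 0\<close> by simp
  \<comment> \<open>Nonnegative coefficients make \<open>F\<close> increasing, so the limit in
    \<open>N\<close> bounds \<open>F M\<close> for each fixed \<open>M\<close>.\<close>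
  moreover have "F M \<le> norm (L_partial \<xi> N) / (1 - t) + real q + real N * t ^ N / (1 - t)" if "N \<ge> M" for N
  proof -
    have "F M \<le> F N"
      unfolding F_def using that t divisor_sum_real[OF real]
      by (intro sum_mono2 mult_nonneg_nonneg) auto
    then show ?thesis using F_le[of N] by linarith
  qed
  ultimately have "F M \<le> real q" by (intro LIMSEQ_le_const) auto
  then show ?thesis by (simp add: F_def)
qed

text \<open>Letting \<open>t\<close> tend to 1 bounds every finite sum of coefficients by
  \<open>q\<close>. The squares of \<open>1, ..., q + 1\<close> alone contribute
  \<open>q + 1\<close>.\<close>

lemma L_one_nonzero_if_real:
  assumes real: "\<And>n. \<xi> n \<in> \<real>"
  shows "L_one \<xi> \<noteq> 0"
proof
  assume "L_one \<xi> = 0"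
  define f where "f m = (\<Sum>d | d dvd m. Re (\<xi> d))" for m
  have bound: "(\<Sum>m=1..M. f m) \<le> real q" for M
  proof (rule tendsto_upperbound)
    show "((\<lambda>t. \<Sum>m=1..M. f m * t ^ m) \<longlongrightarrow> (\<Sum>m=1..M. f m)) (at_left 1)"
      by (rule tendsto_eq_intros refl | simp)+
    show "\<forall>\<^sub>F t in at_left 1. (\<Sum>m=1..M. f m * t ^ m) \<le> real q"
      using eventually_at_left_real[of 0 "1::real"]
      by (auto elim!: eventually_mono simp: f_def intro: lambert_bound[OF real \<open>L_one \<xi> = 0\<close>, simplified])
  qed simp
  define K where "K = Suc q"
  have "real K = (\<Sum>j=1..K. 1)" by simp
  also have "\<dots> \<le> (\<Sum>j=1..K. f (j ^ 2))"
    using divisor_sum_real[OF real] by (intro sum_mono) (auto simp: f_def)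
  also have "\<dots> = (\<Sum>m\<in>(\<lambda>j. j ^ 2) ` {1..K}. f m)"
    by (subst sum.reindex) (auto simp: inj_on_def)
  also have "\<dots> \<le> (\<Sum>m=1..K ^ 2. f m)"
    using divisor_sum_real[OF real] by (intro sum_mono2) (auto simp: f_def power_mono)
  also have "\<dots> \<le> real q" by (rule bound)
  finally show False by (simp add: K_def)
qed

end

section \<open>Prime powers in arithmetic progressions\<close>

text \<open>The terms \<open>n = q * j + 1 \<le> 2 * q * j\<close> alone dominate a multiple of the
  harmonic series.\<close>

lemma sum_principal_char_over_unbounded:
  assumes "q > 0"
  shows "\<exists>N. B \<le> (\<Sum>n=1..N. Re (principal_char q n) / real n)"
proof -
  obtain J :: nat where J: "exp (2 * real q * B) \<le> real J" using real_arch_simple by blast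
  have "real J > 0" using J exp_gt_zero[of "2 * real q * B"] by linarith
  then have "2 * real q * B \<le> ln (real J)" using J by (subst ln_ge_iff) auto
  also have "\<dots> \<le> ln (real J + 1)" using \<open>real J > 0\<close> by simp
  also have "\<dots> \<le> harm J" by (rule ln_le_harm)
  finally have "B \<le> harm J / (2 * real q)" using assms by (simp add: field_simps)
  also have "\<dots> = (\<Sum>j=1..J. 1 / (2 * real q * real j))"
    unfolding harm_def sum_divide_distrib by (intro sum.cong refl) (simp add: field_simps)
  also have "\<dots> \<le> (\<Sum>j=1..J. Re (principal_char q (q * j + 1)) / real (q * j + 1))"
  proof (rule sum_mono)
    fix j assume "j \<in> {1..J}"
    then have "1 \<le> q * j" using assms by (simp add: Suc_le_eq)
    then have "real (q * j + 1) \<le> real (2 * (q * j))" by (simp only: of_nat_le_iff)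
    then have "real (q * j + 1) \<le> 2 * real q * real j" by simp
    moreover have "[q * j + 1 = 0 + 1] (mod q)" by (intro cong_add cong_refl) (simp add: cong_0_iff)
    then have "coprime (q * j + 1) q" using coprime_cong_nat by fastforce
    ultimately show "1 / (2 * real q * real j) \<le> Re (principal_char q (q * j + 1)) / real (q * j + 1)"
      by (simp add: principal_char_def frac_le del: of_nat_add of_nat_mult of_nat_Suc)
  qed
  also have "\<dots> = (\<Sum>n\<in>(\<lambda>j. q * j + 1) ` {1..J}. Re (principal_char q n) / real n)"
    using assms by (subst sum.reindex) (auto simp: inj_on_def)
  also have "\<dots> \<le> (\<Sum>n=1..q * J + 1. Re (principal_char q n) / real n)"
    by (intro sum_mono2) (auto simp: principal_char_def)
  finally show ?thesis by blast
qed

text \<open>Let \<open>H\<close> be the partial sums of \<open>1/n\<close> over \<open>n\<close>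
  prime to \<open>q\<close>. As \<open>H (N div d) \<le> H N\<close>, the sum of
  \<open>log n / n\<close> over such \<open>n \<le> N\<close> is at most \<open>H N\<close> times
  the sum in question. It is also at least \<open>log K * (H N - H K)\<close>, so for
  \<open>N\<close> large the latter sum is at least \<open>log K / 2\<close>.\<close>

lemma mangoldt_partial_principal_unbounded:
  assumes "q > 0"
  shows "\<exists>N. B \<le> Re (mangoldt_partial (principal_char q) N)"
proof -
  define r where "r n = Re (principal_char q n)" for n
  have r: "0 \<le> r n" "principal_char q n = of_real (r n)" for n
    by (auto simp: r_def principal_char_def)
  define H where "H N = (\<Sum>m=1..N. r m / real m)" for N
  have H_mono: "H M \<le> H N" if "M \<le> N" for M N
    unfolding H_def using that r by (intro sum_mono2) auto
  obtain K :: nat where K: "exp (2 * B) \<le> real K" using real_arch_simple by blast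
  have "real K > 0" using K exp_gt_zero[of "2 * B"] by linarith
  then have lnK: "2 * B \<le> ln (real K)" "0 \<le> ln (real K)" using K by (auto simp: ln_ge_iff)
  \<comment> \<open>This makes \<open>H N - H K \<ge> H N / 2\<close>; the added 1 gives
    \<open>H K < H N\<close>, hence \<open>K \<le> N\<close>.\<close>
  obtain N where N: "2 * H K + 1 \<le> H N"
    using sum_principal_char_over_unbounded[OF assms] unfolding H_def r_def by blast
  have "0 \<le> H K" unfolding H_def using r by (intro sum_nonneg) auto
  then have "H K < H N" using N by linarith
  then have "K \<le> N" using H_mono[of N K] by linarith
  have "ln (real K) * (H N - H K) = (\<Sum>n=Suc K..N. ln (real K) * (r n / real n))"
  proof -
    have "{1..N} = {1..K} \<union> {Suc K..N}" using \<open>K \<le> N\<close> by auto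
    then have "H N = H K + (\<Sum>n=Suc K..N. r n / real n)"
      unfolding H_def by (simp only:) (rule sum.union_disjoint, auto)
    then show ?thesis by (simp add: sum_distrib_left)
  qed
  also have "\<dots> \<le> (\<Sum>n=Suc K..N. r n * ln (real n) / real n)"
  proof (rule sum_mono)
    fix n assume n: "n \<in> {Suc K..N}"
    then have "ln (real K) \<le> ln (real n)" using \<open>real K > 0\<close> by simp
    then have "ln (real K) * (r n / real n) \<le> ln (real n) * (r n / real n)"
      using r by (intro mult_right_mono) auto
    then show "ln (real K) * (r n / real n) \<le> r n * ln (real n) / real n" by (simp add: mult.commute)
  qed
  also have "\<dots> \<le> (\<Sum>n=1..N. r n * ln (real n) / real n)"
    using r by (intro sum_mono2) auto
  also have "\<dots> = Re (\<Sum>n=1..N. principal_char q n * of_real (ln (real n)) / of_nat n)"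
    by (simp add: r)
  also have "\<dots> = (\<Sum>d=1..N. r d * mangoldt d / real d * H (N div d))"
  proof -
    have "principal_char q d * of_real (mangoldt d) / of_nat d * (\<Sum>m=1..N div d. principal_char q m / of_nat m)
        = of_real (r d * mangoldt d / real d * H (N div d))" for d
      by (simp add: r H_def)
    then show ?thesis
      unfolding sum_dchar_ln[OF principal_char_in_dchars] by (simp only: of_real_sum[symmetric] Re_complex_of_real)
  qed
  also have "\<dots> \<le> (\<Sum>d=1..N. r d * mangoldt d / real d * H N)"
    using r by (intro sum_mono mult_left_mono H_mono) (auto simp: mangoldt_nonneg)
  also have "\<dots> = Re (mangoldt_partial (principal_char q) N) * H N"
  proof -
    have "mangoldt_partial (principal_char q) N = of_real (\<Sum>d=1..N. r d * mangoldt d / real d)"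
      by (simp add: mangoldt_partial_def r)
    then show ?thesis by (simp only: Re_complex_of_real sum_distrib_right)
  qed
  finally have "ln (real K) * (H N - H K) \<le> Re (mangoldt_partial (principal_char q) N) * H N" .
  moreover have "ln (real K) * (H N / 2) \<le> ln (real K) * (H N - H K)"
    using N lnK by (intro mult_left_mono) auto
  ultimately have "ln (real K) / 2 * H N \<le> Re (mangoldt_partial (principal_char q) N) * H N" by simp
  then have "ln (real K) / 2 \<le> Re (mangoldt_partial (principal_char q) N)"
    using \<open>0 \<le> H K\<close> \<open>H K < H N\<close> by (subst (asm) mult_le_cancel_right_pos) auto
  then show ?thesis using lnK(1) by (intro exI[of _ N]) linarith
qed

text \<open>Orthogonality of characters. The factor \<open>\<xi> b\<close> selects the class inverse
  to \<open>b\<close>, which avoids conjugates.\<close>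

lemma sum_dchars_mangoldt_partial:
  assumes "q > 0"
  shows "(\<Sum>\<xi>\<in>dchars q. \<xi> b * mangoldt_partial \<xi> N)
       = of_real (real (card (dchars q)) * (\<Sum>n | n \<in> {1..N} \<and> [b * n = 1] (mod q). mangoldt n / real n))"
proof -
  have "(\<Sum>\<xi>\<in>dchars q. \<xi> b * mangoldt_partial \<xi> N)
     = (\<Sum>\<xi>\<in>dchars q. \<Sum>n=1..N. \<xi> (b * n) * of_real (mangoldt n / real n))"
    unfolding mangoldt_partial_def sum_distrib_left by (intro sum.cong refl) (simp add: dcharsD(1))
  also have "\<dots> = (\<Sum>n=1..N. (\<Sum>\<xi>\<in>dchars q. \<xi> (b * n)) * of_real (mangoldt n / real n))"
    by (subst sum.swap) (simp only: sum_distrib_right)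
  also have "\<dots> = (\<Sum>n=1..N. if [b * n = 1] (mod q) then of_nat (card (dchars q)) * of_real (mangoldt n / real n) else 0)"
    unfolding sum_dchars[OF assms] by (intro sum.cong refl) auto
  also have "\<dots> = (\<Sum>n | n \<in> {1..N} \<and> [b * n = 1] (mod q). of_nat (card (dchars q)) * of_real (mangoldt n / real n))"
    by (subst sum.inter_filter[symmetric]) auto
  finally show ?thesis by (simp add: sum_distrib_left)
qed

section \<open>Nonvanishing of \<open>L(1, \<xi>)\<close> for every nonprincipal character\<close>

context nonprincipal_char
begin

text \<open>Both alternatives for \<open>L(1, \<xi>)\<close> give an upper bound, so this can be
  used before nonvanishing is known.\<close>

lemma Re_mangoldt_partial_bounded_above: "\<exists>C. \<forall>N>0. Re (mangoldt_partial \<xi> N) \<le> C"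
proof (cases "L_one \<xi> = 0")
  case True
  have "Re (mangoldt_partial \<xi> N) \<le> real q" if "N > 0" for N
  proof -
    have "Re (mangoldt_partial \<xi> N + of_real (ln (real N))) \<le> real q"
      using mangoldt_partial_if_L_one_zero[OF True that] complex_Re_le_cmod order.trans by blast
    moreover have "0 \<le> ln (real N)" using that by simp
    ultimately show ?thesis by simp
  qed
  then show ?thesis by blast
next
  case False
  then show ?thesis using mangoldt_partial_bounded complex_Re_le_cmod order.trans by blast
qed

theorem L_one_nonzero: "L_one \<xi> \<noteq> 0"
proof
  assume L0: "L_one \<xi> = 0"
  define \<eta> where "\<eta> n = cnj (\<xi> n)" for n
  have \<eta>: "\<eta> \<in> dchars q" unfolding \<eta>_def by (rule dchars_cnj[OF dchar])
  have "\<eta> \<noteq> \<xi>"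
  proof
    assume "\<eta> = \<xi>"
    then have "\<xi> n \<in> \<real>" for n unfolding \<eta>_def by (metis Reals_cnj_iff)
    then show False using L_one_nonzero_if_real L0 by blast
  qed
  have "\<eta> \<noteq> principal_char q"
  proof
    assume "\<eta> = principal_char q"
    then have "cnj (\<xi> n) = principal_char q n" for n unfolding \<eta>_def by metis
    then have "\<xi> n = principal_char q n" for n by (metis complex_cnj_cnj complex_cnj_one complex_cnj_zero principal_char_def)
    then show False using nonprincipal by auto
  qed
  \<comment> \<open>The coefficient of \<open>log N\<close> in an upper bound for the sum attached
    to \<open>\<phi>\<close>. It totals \<open>1 - 1 - 1 = -1\<close> over all characters, against
    the nonnegativity of the sum over all characters.\<close>
  define w :: "(nat \<Rightarrow> complex) \<Rightarrow> real"
    where "w \<phi> = (if \<phi> = principal_char q then 1 else 0) - (if \<phi> = \<xi> then 1 else 0) - (if \<phi> = \<eta> then 1 else 0)" for \<phi>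
  have bound_\<xi>: "Re (mangoldt_partial \<xi> N) \<le> real q - ln (real N)" if "N > 0" for N
    using mangoldt_partial_if_L_one_zero[OF L0 that]
      complex_Re_le_cmod[of "mangoldt_partial \<xi> N + of_real (ln (real N))"] by simp
  have cnj: "mangoldt_partial \<eta> N = cnj (mangoldt_partial \<xi> N)" for N
    unfolding mangoldt_partial_def \<eta>_def by (simp del: of_real_mangoldt)
  have "\<exists>C. \<forall>N>0. Re (mangoldt_partial \<phi> N) \<le> C + w \<phi> * ln (real N)" if \<phi>: "\<phi> \<in> dchars q" for \<phi>
  proof -
    consider "\<phi> = principal_char q" | "\<phi> \<noteq> principal_char q" "\<phi> = \<xi> \<or> \<phi> = \<eta>"
      | "\<phi> \<noteq> principal_char q" "\<phi> \<noteq> \<xi>" "\<phi> \<noteq> \<eta>" by blast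
    then show ?thesis
    proof cases
      case 1
      then have w: "w \<phi> = 1" using nonprincipal \<open>\<eta> \<noteq> principal_char q\<close> by (auto simp: w_def)
      have "Re (mangoldt_partial \<phi> N) \<le> 6 + ln (real N)" if "N > 0" for N
      proof -
        have "Re (mangoldt_partial \<phi> N) \<le> (\<Sum>n=1..N. mangoldt n / real n)"
          unfolding mangoldt_partial_def 1 Re_sum
          by (intro sum_mono) (simp add: principal_char_def mangoldt_nonneg)
        then show ?thesis using sum_mangoldt_over_le[OF that] by simp
      qed
      then show ?thesis unfolding w by auto
    next
      case 2
      then have w: "w \<phi> = - 1" using nonprincipal \<open>\<eta> \<noteq> \<xi>\<close> by (auto simp: w_def)
      have "Re (mangoldt_partial \<phi> N) = Re (mangoldt_partial \<xi> N)" for N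
        using 2(2) cnj by auto
      then show ?thesis unfolding w using bound_\<xi> by (intro exI[of _ "real q"]) simp
    next
      case 3
      then interpret \<phi>: nonprincipal_char q \<phi> by unfold_locales (use q_pos \<phi> in auto)
      have "w \<phi> = 0" using 3 by (simp add: w_def)
      then show ?thesis using \<phi>.Re_mangoldt_partial_bounded_above by simp
    qed
  qed
  then obtain C where C: "\<And>\<phi> N. \<phi> \<in> dchars q \<Longrightarrow> N > 0 \<Longrightarrow> Re (mangoldt_partial \<phi> N) \<le> C \<phi> + w \<phi> * ln (real N)"
    by metis
  have sum_w: "(\<Sum>\<phi>\<in>dchars q. w \<phi>) = - 1"
    unfolding w_def using finite_dchars[OF q_pos] dchar \<eta> principal_char_in_dchars[of q]
    by (simp add: sum_subtractf)
  have ln_le: "ln (real N) \<le> (\<Sum>\<phi>\<in>dchars q. C \<phi>)" if "N > 0" for N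
  proof -
    have "(\<Sum>\<phi>\<in>dchars q. mangoldt_partial \<phi> N) = (\<Sum>\<phi>\<in>dchars q. \<phi> 1 * mangoldt_partial \<phi> N)"
      by (intro sum.cong) auto
    also have "Re \<dots> \<ge> 0"
      unfolding sum_dchars_mangoldt_partial[OF q_pos] Re_complex_of_real
      by (intro mult_nonneg_nonneg sum_nonneg divide_nonneg_nonneg mangoldt_nonneg) auto
    finally have "0 \<le> (\<Sum>\<phi>\<in>dchars q. Re (mangoldt_partial \<phi> N))" by simp
    also have "\<dots> \<le> (\<Sum>\<phi>\<in>dchars q. C \<phi> + w \<phi> * ln (real N))"
      using C that by (intro sum_mono) auto
    also have "\<dots> = (\<Sum>\<phi>\<in>dchars q. C \<phi>) - ln (real N)"
      by (simp add: sum.distrib sum_w flip: sum_distrib_right)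
    finally show ?thesis by simp
  qed
  obtain N :: nat where N: "exp (sum C (dchars q) + 1) \<le> real N" using real_arch_simple by blast
  then have "real N > 0" using exp_gt_zero[of "sum C (dchars q) + 1"] by linarith
  then have "sum C (dchars q) + 1 \<le> ln (real N)" using N by (subst ln_ge_iff) auto
  moreover have "N > 0" using \<open>real N > 0\<close> by simp
  ultimately show False using ln_le[of N] by linarith
qed

end

text \<open>With \<open>b\<close> the inverse of \<open>a\<close> modulo \<open>q\<close>,
  orthogonality isolates the progression. The principal character contributes an unbounded amount
  and all others together a bounded one.\<close>

theorem sum_mangoldt_progression_unbounded:
  assumes q: "q > 0" and a: "coprime a q"
  shows "\<exists>N. B \<le> (\<Sum>n | n \<in> {1..N} \<and> [n = a] (mod q). mangoldt n / real n)"
proof -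
  define b where "b = a ^ (totient q - 1)"
  have b: "coprime b q" unfolding b_def using a by simp
  have "b * a = a ^ totient q" unfolding b_def using q by (simp add: power_eq_if)
  then have ba: "[b * a = 1] (mod q)" using euler_theorem[OF a] by simp
  have iff: "[b * n = 1] (mod q) \<longleftrightarrow> [n = a] (mod q)" for n
    using cong_mult_lcancel_nat[OF b, of n a] ba cong_trans cong_sym by blast
  define D where "D = dchars q - {principal_char q}"
  have fin: "finite D" "finite (dchars q)" unfolding D_def using finite_dchars[OF q] by auto
  have "\<exists>C. \<forall>N. norm (mangoldt_partial \<phi> N) \<le> C" if "\<phi> \<in> D" for \<phi>
  proof -
    interpret nonprincipal_char q \<phi> by unfold_locales (use q that in \<open>auto simp: D_def\<close>)
    show ?thesis using mangoldt_partial_bounded L_one_nonzero by blast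
  qed
  then obtain C where C: "\<And>\<phi> N. \<phi> \<in> D \<Longrightarrow> norm (mangoldt_partial \<phi> N) \<le> C \<phi>" by metis
  define c where "c = real (card (dchars q))"
  have c: "c > 0" unfolding c_def using fin(2) principal_char_in_dchars[of q] by (auto simp: card_gt_0_iff)
  obtain N where N: "c * B + sum C D \<le> Re (mangoldt_partial (principal_char q) N)"
    using mangoldt_partial_principal_unbounded[OF q] by blast
  define X where "X = (\<Sum>n | n \<in> {1..N} \<and> [n = a] (mod q). mangoldt n / real n)"
  have "of_real (c * X) = (\<Sum>\<phi>\<in>dchars q. \<phi> b * mangoldt_partial \<phi> N)"
    unfolding sum_dchars_mangoldt_partial[OF q] iff X_def c_def ..
  also have "\<dots> = principal_char q b * mangoldt_partial (principal_char q) N + (\<Sum>\<phi>\<in>D. \<phi> b * mangoldt_partial \<phi> N)"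
    unfolding D_def by (rule sum.remove[OF fin(2) principal_char_in_dchars])
  also have "principal_char q b = 1" using b by (simp add: principal_char_def)
  finally have "c * X = Re (mangoldt_partial (principal_char q) N + (\<Sum>\<phi>\<in>D. \<phi> b * mangoldt_partial \<phi> N))"
    by (metis Re_complex_of_real mult_1)
  then have "c * X = Re (mangoldt_partial (principal_char q) N) + Re (\<Sum>\<phi>\<in>D. \<phi> b * mangoldt_partial \<phi> N)" by simp
  moreover have "norm (\<Sum>\<phi>\<in>D. \<phi> b * mangoldt_partial \<phi> N) \<le> (\<Sum>\<phi>\<in>D. C \<phi>)"
  proof (rule sum_norm_le)
    fix \<phi> assume "\<phi> \<in> D"
    then have "norm (\<phi> b) * norm (mangoldt_partial \<phi> N) \<le> 1 * C \<phi>"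
      using norm_dchar_le_1[of \<phi> q b] C[of \<phi> N] q by (intro mult_mono) (auto simp: D_def)
    then show "norm (\<phi> b * mangoldt_partial \<phi> N) \<le> C \<phi>" by (simp add: norm_mult)
  qed
  ultimately have "c * B \<le> c * X"
    using N abs_Re_le_cmod[of "\<Sum>\<phi>\<in>D. \<phi> b * mangoldt_partial \<phi> N"] by linarith
  then have "B \<le> X" using c by simp
  then show ?thesis unfolding X_def by blast
qed

text \<open>Otherwise only \<open>n = a\<close> could contribute to the sum over the progression,
  which would then be bounded.\<close>

lemma ex_mangoldt_progression_pos:
  assumes "a < q" "coprime a q"
  shows "\<exists>m>0. mangoldt (q * m + a) > (0::real)"
proof (rule ccontr)
  assume "\<not> ?thesis"
  then have zero: "mangoldt (q * m + a) = (0::real)" if "m > 0" for m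
    using that mangoldt_nonneg[of "q * m + a"] by (metis order_le_less)
  obtain N where N: "mangoldt a / real a + 1 \<le> (\<Sum>n | n \<in> {1..N} \<and> [n = a] (mod q). mangoldt n / real n)"
    using sum_mangoldt_progression_unbounded[of q a "mangoldt a / real a + 1"] assms by auto
  define A where "A = {n. n \<in> {1..N} \<and> [n = a] (mod q)}"
  have "(\<Sum>n\<in>A. mangoldt n / real n) = (\<Sum>n\<in>A \<inter> {a}. mangoldt n / real n)"
  proof (rule sum.mono_neutral_right)
    show "\<forall>n\<in>A - A \<inter> {a}. mangoldt n / real n = 0"
    proof
      fix n assume n: "n \<in> A - A \<inter> {a}"
      then have "n mod q = a" using assms(1) by (simp add: A_def cong_def)
      then have eq: "n = q * (n div q) + a" by (metis mult_div_mod_eq)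
      then have "n div q > 0" using n by (cases "n div q") auto
      then show "mangoldt n / real n = 0" using zero[of "n div q"] eq by simp
    qed
  qed (auto simp: A_def)
  also have "\<dots> \<le> (\<Sum>n\<in>{a}. mangoldt n / real n)"
    by (intro sum_mono2) (auto simp: mangoldt_nonneg)
  finally have "(\<Sum>n\<in>A. mangoldt n / real n) \<le> mangoldt a / real a" by simp
  then show False using N unfolding A_def by simp
qed

section \<open>The sum over floor quotients\<close>

text \<open>The condition means \<open>x/(m + 1) < n \<le> x/m\<close>, so the count is a difference
  of two integer parts, each within 1 below its argument.\<close>

lemma card_floor_quotient:
  assumes x: "x \<ge> 1" and m: "m > 0"
  shows "\<bar>real (card {n \<in> {1..nat \<lfloor>x\<rfloor>}. nat \<lfloor>x / real n\<rfloor> = m}) - x / (real m * real (m + 1))\<bar> \<le> 1"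
proof -
  have "{n \<in> {1..nat \<lfloor>x\<rfloor>}. nat \<lfloor>x / real n\<rfloor> = m} = {nat \<lfloor>x / real (m + 1)\<rfloor><..nat \<lfloor>x / real m\<rfloor>}"
  proof (intro equalityI subsetI)
    fix n assume n: "n \<in> {n \<in> {1..nat \<lfloor>x\<rfloor>}. nat \<lfloor>x / real n\<rfloor> = m}"
    then have "\<lfloor>x / real n\<rfloor> = int m" using m by auto
    then have "real m \<le> x / real n" "x / real n < real m + 1" by linarith+
    then have "real n \<le> x / real m" "x / real (m + 1) < real n" using n m by (auto simp: field_simps)
    then show "n \<in> {nat \<lfloor>x / real (m + 1)\<rfloor><..nat \<lfloor>x / real m\<rfloor>}"
      using x by (auto simp: nat_less_iff floor_less_iff le_nat_floor)
  next
    fix n assume n: "n \<in> {nat \<lfloor>x / real (m + 1)\<rfloor><..nat \<lfloor>x / real m\<rfloor>}"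
    have "0 < n" using n by auto
    have 1: "real n \<le> x / real m" 
    proof -
      have "real n \<le> real (nat \<lfloor>x / real m\<rfloor>)" using n by simp
      also have "\<dots> \<le> x / real m" using x by (intro of_nat_floor) auto
      finally show ?thesis .
    qed
    have 2: "x / real (m + 1) < real n" using n x by (auto simp: nat_less_iff floor_less_iff)
    have "x / real m \<le> x / 1" using x m by (intro divide_left_mono) auto
    with 1 have "n \<le> nat \<lfloor>x\<rfloor>" by (simp add: le_nat_floor)
    moreover have "real m \<le> x / real n" "x / real n < real m + 1"
      using 1 2 m \<open>0 < n\<close> by (auto simp: field_simps)
    then have "\<lfloor>x / real n\<rfloor> = int m" by (intro floor_unique) auto
    ultimately show "n \<in> {n \<in> {1..nat \<lfloor>x\<rfloor>}. nat \<lfloor>x / real n\<rfloor> = m}" using \<open>0 < n\<close> by simp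
  qed
  then have card: "card {n \<in> {1..nat \<lfloor>x\<rfloor>}. nat \<lfloor>x / real n\<rfloor> = m} = nat \<lfloor>x / real m\<rfloor> - nat \<lfloor>x / real (m + 1)\<rfloor>"
    by simp
  define y z where "y = x / real m" and "z = x / real (m + 1)"
  have yz: "0 \<le> z" "z \<le> y" unfolding y_def z_def using x m by (auto intro!: divide_left_mono)
  then have "\<lfloor>z\<rfloor> \<le> \<lfloor>y\<rfloor>" "0 \<le> \<lfloor>z\<rfloor>" by (auto intro: floor_mono)
  then have "real (nat \<lfloor>y\<rfloor> - nat \<lfloor>z\<rfloor>) = of_int \<lfloor>y\<rfloor> - of_int \<lfloor>z\<rfloor>" using yz by (simp add: of_nat_diff nat_mono)
  moreover have "x / (real m * real (m + 1)) = y - z"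
    unfolding y_def z_def using m by (simp add: field_simps)
  moreover have "\<bar>(of_int \<lfloor>y\<rfloor> - of_int \<lfloor>z\<rfloor>) - (y - z)\<bar> \<le> 1" by linarith
  ultimately show ?thesis unfolding card y_def[symmetric] z_def[symmetric] by simp
qed

section \<open>The density series and the error term\<close>

context
  fixes a q :: nat
  assumes a_pos: "0 < a" and a_less: "a < q"
begin

lemma mangoldt_progression_le: "mangoldt (q * m + a) \<le> ln (real (q * m + a))"
  using a_pos by (intro mangoldt_le) auto

text \<open>From \<open>m\<close> to \<open>m + 1\<close> the logarithm grows by at most
  \<open>1/m\<close>, and the summand 1 beside the logarithm absorbs this growth.\<close>

lemma dens_term_telescope:
  assumes "m > 0"
  shows "mangoldt (q * m + a) / (real m * real (m + 1))
     \<le> (ln (real (q * m + a)) + 1) / real m - (ln (real (q * Suc m + a)) + 1) / real (Suc m)"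
proof -
  define l l' where "l = ln (real (q * m + a))" and "l' = ln (real (q * Suc m + a))"
  have "l' - l \<le> (real (q * Suc m + a) - real (q * m + a)) / real (q * m + a)"
    unfolding l_def l'_def using a_pos by (intro ln_diff_le) (simp_all del: of_nat_add of_nat_mult)
  also have "\<dots> = real q / real (q * m + a)" by (simp add: algebra_simps)
  also have "\<dots> \<le> real q / (real q * real m)"
    using a_less assms by (intro divide_left_mono) (auto intro!: mult_pos_pos add_pos_nonneg)
  also have "\<dots> = 1 / real m" using a_less by simp
  finally have *: "real m * (l' - l) \<le> 1" using assms by (simp add: field_simps)
  have "mangoldt (q * m + a) / (real m * real (m + 1)) \<le> l / (real m * real (m + 1))"
    unfolding l_def using mangoldt_progression_le by (intro divide_right_mono) auto
  also have "\<dots> \<le> ((l + 1) * real (Suc m) - (l' + 1) * real m) / (real m * real (m + 1))"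
    using * by (intro divide_right_mono) (auto simp: algebra_simps)
  also have "\<dots> = (l + 1) / real m - (l' + 1) / real (Suc m)"
    using assms by (simp add: diff_divide_distrib add.commute)
  finally show ?thesis unfolding l_def l'_def .
qed

text \<open>The offset \<open>M\<close> serves two purposes: \<open>M = 0\<close> gives summability,
  general \<open>M\<close> bounds the tail.\<close>

lemma dens_partial_le:
  "(\<Sum>n<k. mangoldt (q * Suc (n + M) + a) / (real (Suc (n + M)) * real (Suc (n + M) + 1)))
     \<le> (ln (real (q * Suc M + a)) + 1) / real (Suc M)"
proof -
  define g where "g m = (ln (real (q * m + a)) + 1) / real m" for m
  have "(\<Sum>n<k. mangoldt (q * Suc (n + M) + a) / (real (Suc (n + M)) * real (Suc (n + M) + 1)))
     \<le> (\<Sum>n<k. g (Suc n + M) - g (Suc (Suc n) + M))"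
  proof (rule sum_mono)
    fix n
    show "mangoldt (q * Suc (n + M) + a) / (real (Suc (n + M)) * real (Suc (n + M) + 1)) \<le> g (Suc n + M) - g (Suc (Suc n) + M)"
      using dens_term_telescope[of "Suc (n + M)"] unfolding g_def add_Suc by simp
  qed
  also have "\<dots> = g (Suc M) - g (Suc k + M)"
    using sum_lessThan_telescope'[of "\<lambda>n. g (Suc n + M)" k] by simp
  also have "\<dots> \<le> g (Suc M)"
  proof -
    have "0 \<le> ln (real (q * (Suc k + M) + a))" using a_pos by (intro ln_ge_zero) linarith
    then show ?thesis by (simp add: g_def del: of_nat_add of_nat_mult)
  qed
  finally show ?thesis by (simp add: g_def)
qed

lemma dens_summable: "summable (\<lambda>n. mangoldt (q * Suc n + a) / (real (Suc n) * real (Suc n + 1)) :: real)"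
proof (rule summableI_nonneg_bounded)
  show "0 \<le> mangoldt (q * Suc n + a) / (real (Suc n) * real (Suc n + 1))" for n
    by (intro divide_nonneg_nonneg mult_nonneg_nonneg mangoldt_nonneg) auto
  show "(\<Sum>n<k. mangoldt (q * Suc n + a) / (real (Suc n) * real (Suc n + 1)))
      \<le> (ln (real (q * Suc 0 + a)) + 1) / real (Suc 0)" for k
    using dens_partial_le[of 0 k] by (simp only: add_0_right)
qed

lemma dens_const_tail:
  "\<bar>dens_const a q - (\<Sum>m=1..M. mangoldt (q * m + a) / (real m * real (m + 1)))\<bar>
     \<le> (ln (real (q * Suc M + a)) + 1) / real (Suc M)"
proof -
  define u :: "nat \<Rightarrow> real" where "u n = mangoldt (q * Suc n + a) / (real (Suc n) * real (Suc n + 1))" for n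
  have u: "summable u" "\<And>n. 0 \<le> u n"
    unfolding u_def using dens_summable by (auto intro!: divide_nonneg_nonneg mangoldt_nonneg)
  have "dens_const a q = (\<Sum>n. u (n + M)) + (\<Sum>n<M. u n)"
    unfolding dens_const_def u_def[symmetric] by (rule suminf_split_initial_segment[OF u(1)])
  moreover have "(\<Sum>n<M. u n) = (\<Sum>m=1..M. mangoldt (q * m + a) / (real m * real (m + 1)))"
    unfolding u_def by (rule sum.reindex_bij_witness[of _ "\<lambda>m. m - 1" Suc]) auto
  moreover have "0 \<le> (\<Sum>n. u (n + M))"
    using u by (intro suminf_nonneg) (auto simp: summable_iff_shift)
  moreover have "(\<Sum>n. u (n + M)) \<le> (ln (real (q * Suc M + a)) + 1) / real (Suc M)"
  proof (rule suminf_le_const)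
    show "summable (\<lambda>n. u (n + M))" using u(1) by (simp add: summable_iff_shift)
    show "(\<Sum>n<k. u (n + M)) \<le> (ln (real (q * Suc M + a)) + 1) / real (Suc M)" for k
      unfolding u_def by (rule dens_partial_le)
  qed
  ultimately show ?thesis by linarith
qed

text \<open>Cut at \<open>M = [sqrt x]\<close>. The counting errors for \<open>m \<le> M\<close>,
  the \<open>n\<close> with quotient above \<open>M\<close>, and the tail of the density series each
  cost \<open>sqrt x\<close> times the logarithm; the tail adds a further
  \<open>sqrt x\<close>.\<close>

lemma sum_floor_quotient_error:
  assumes x: "x \<ge> 1"
  shows "\<bar>(\<Sum>n\<in>{1..nat \<lfloor>x\<rfloor>}. mangoldt (q * nat \<lfloor>x / real n\<rfloor> + a)) - dens_const a q * x\<bar>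
     \<le> sqrt x * (3 * ln (3 * real q * x) + 1)"
proof -
  define f :: "nat \<Rightarrow> real" where "f m = mangoldt (q * m + a)" for m
  define v where "v n = nat \<lfloor>x / real n\<rfloor>" for n :: nat
  define A where "A = {1..nat \<lfloor>x\<rfloor>}"
  define M where "M = nat \<lfloor>sqrt x\<rfloor>"
  define l where "l = ln (3 * real q * x)"
  have sqrt_x: "1 \<le> sqrt x" "sqrt x * sqrt x = x" "sqrt x \<le> x"
    using x by (auto simp: real_sqrt_le_iff real_le_lsqrt power2_eq_square)
  have "real M = of_int \<lfloor>sqrt x\<rfloor>" unfolding M_def using x by simp
  then have M: "real M \<le> sqrt x" "sqrt x \<le> real (Suc M)" by linarith+
  \<comment> \<open>The range reaches \<open>x + 1\<close> because the tail bound evaluates the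
    logarithm at \<open>Suc M\<close>.\<close>
  have ln_le: "ln (real (q * m + a)) \<le> l" if "real m \<le> x + 1" for m
  proof -
    have "real (q * m + a) \<le> real q * real m + real q" using a_less by simp
    also have "\<dots> \<le> real q * (x + 1) + real q * x"
      using that x by (intro add_mono mult_left_mono) (auto simp: mult_le_cancel_left1)
    also have "\<dots> \<le> 3 * real q * x"
      using mult_left_mono[OF x, of "real q"] by (simp add: algebra_simps)
    finally show ?thesis unfolding l_def using a_pos by (intro ln_mono) (simp_all del: of_nat_add of_nat_mult)
  qed
  have f_le: "f m \<le> l" if "real m \<le> x" for m
    unfolding f_def using mangoldt_progression_le[of m] ln_le[of m] that by linarith
  have f_nonneg: "0 \<le> f m" for m unfolding f_def by (rule mangoldt_nonneg)
  have l_nonneg: "0 \<le> l" using f_le[of 0] f_nonneg[of 0] x by simp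
  have v: "1 \<le> v n" "real (v n) \<le> x" if "n \<in> A" for n
  proof -
    have n: "1 \<le> real n" "real n \<le> x" using that x by (auto simp: A_def le_nat_iff le_floor_iff)
    then show "1 \<le> v n" unfolding v_def by (simp add: le_nat_iff le_floor_iff)
    have "x / real n \<le> x / 1" using n x by (intro divide_left_mono) auto
    moreover have "real (v n) \<le> x / real n" unfolding v_def using x by simp
    ultimately show "real (v n) \<le> x" by simp
  qed
  have "(\<Sum>n\<in>A. f (v n)) = (\<Sum>n\<in>{n\<in>A. v n \<le> M}. f (v n)) + (\<Sum>n\<in>{n\<in>A. \<not> v n \<le> M}. f (v n))"
  proof -
    have "A = {n\<in>A. v n \<le> M} \<union> {n\<in>A. \<not> v n \<le> M}" by auto
    moreover have "finite A" by (simp add: A_def)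
    then have "(\<Sum>n\<in>{n\<in>A. v n \<le> M} \<union> {n\<in>A. \<not> v n \<le> M}. f (v n))
       = (\<Sum>n\<in>{n\<in>A. v n \<le> M}. f (v n)) + (\<Sum>n\<in>{n\<in>A. \<not> v n \<le> M}. f (v n))"
      by (intro sum.union_disjoint) auto
    ultimately show ?thesis by simp
  qed
  also have "(\<Sum>n\<in>{n\<in>A. v n \<le> M}. f (v n)) = (\<Sum>m=1..M. \<Sum>n\<in>{n\<in>{n\<in>A. v n \<le> M}. v n = m}. f (v n))"
    using v(1) by (intro sum.group[symmetric]) (auto simp: A_def)
  also have "\<dots> = (\<Sum>m=1..M. real (card {n\<in>A. v n = m}) * f m)"
  proof (intro sum.cong refl)
    fix m assume "m \<in> {1..M}"
    then have "{n\<in>{n\<in>A. v n \<le> M}. v n = m} = {n\<in>A. v n = m}" by auto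
    then show "(\<Sum>n\<in>{n\<in>{n\<in>A. v n \<le> M}. v n = m}. f (v n)) = real (card {n\<in>A. v n = m}) * f m" by simp
  qed
  finally have split: "(\<Sum>n\<in>A. f (v n)) = (\<Sum>m=1..M. real (card {n\<in>A. v n = m}) * f m) + (\<Sum>n\<in>{n\<in>A. \<not> v n \<le> M}. f (v n))" .
  have large: "\<bar>\<Sum>n\<in>{n\<in>A. \<not> v n \<le> M}. f (v n)\<bar> \<le> sqrt x * l"
  proof -
    \<comment> \<open>A quotient above \<open>M\<close> means \<open>x/n \<ge> sqrt x\<close>, that
      is \<open>n \<le> sqrt x\<close>.\<close>
    have sub: "{n\<in>A. \<not> v n \<le> M} \<subseteq> {1..M}"
    proof
      fix n assume n: "n \<in> {n\<in>A. \<not> v n \<le> M}"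
      then have "1 \<le> n" by (auto simp: A_def)
      have "real (Suc M) \<le> real (v n)" using n by (intro of_nat_mono) auto
      also have "\<dots> \<le> x / real n" unfolding v_def using x by simp
      finally have "sqrt x \<le> x / real n" using M by linarith
      then have "sqrt x * real n \<le> sqrt x * sqrt x" using \<open>1 \<le> n\<close> unfolding sqrt_x(2) by (simp add: pos_le_divide_eq)
      then have "real n \<le> sqrt x" using sqrt_x by (subst (asm) mult_le_cancel_left_pos) auto
      then show "n \<in> {1..M}" using \<open>1 \<le> n\<close> unfolding M_def by (simp add: le_nat_floor)
    qed
    have "\<bar>\<Sum>n\<in>{n\<in>A. \<not> v n \<le> M}. f (v n)\<bar> \<le> (\<Sum>n\<in>{n\<in>A. \<not> v n \<le> M}. l)"
      using v(2) f_le f_nonneg by (intro order.trans[OF sum_abs] sum_mono) auto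
    also have "\<dots> = real (card {n\<in>A. \<not> v n \<le> M}) * l" by simp
    also have "\<dots> \<le> sqrt x * l"
    proof (intro mult_right_mono l_nonneg)
      have "card {n\<in>A. \<not> v n \<le> M} \<le> card {1..M}" using sub by (intro card_mono) auto
      then show "real (card {n\<in>A. \<not> v n \<le> M}) \<le> sqrt x" using M by simp
    qed
    finally show ?thesis .
  qed
  have small: "\<bar>(\<Sum>m=1..M. real (card {n\<in>A. v n = m}) * f m) - x * (\<Sum>m=1..M. f m / (real m * real (m + 1)))\<bar> \<le> sqrt x * l"
  proof -
    have "(\<Sum>m=1..M. real (card {n\<in>A. v n = m}) * f m) - x * (\<Sum>m=1..M. f m / (real m * real (m + 1)))
       = (\<Sum>m=1..M. (real (card {n\<in>A. v n = m}) - x / (real m * real (m + 1))) * f m)"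
      by (simp add: left_diff_distrib sum_subtractf sum_distrib_left)
    also have "\<bar>\<dots>\<bar> \<le> (\<Sum>m=1..M. 1 * l)"
    proof (rule order.trans[OF sum_abs], rule sum_mono)
      fix m assume m: "m \<in> {1..M}"
      then have "real m \<le> real M" by simp
      then have "real m \<le> x" using M sqrt_x by linarith
      then have "\<bar>f m\<bar> \<le> l" using f_le f_nonneg by simp
      then have "\<bar>real (card {n\<in>A. v n = m}) - x / (real m * real (m + 1))\<bar> * \<bar>f m\<bar> \<le> 1 * l"
        using card_floor_quotient[OF x, of m] m unfolding A_def v_def by (intro mult_mono) auto
      then show "\<bar>(real (card {n\<in>A. v n = m}) - x / (real m * real (m + 1))) * f m\<bar> \<le> 1 * l"
        by (simp only: abs_mult)
    qed
    also have "\<dots> \<le> sqrt x * l" using M l_nonneg by (simp add: mult_right_mono)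
    finally show ?thesis .
  qed
  have tail: "\<bar>x * (\<Sum>m=1..M. f m / (real m * real (m + 1))) - dens_const a q * x\<bar> \<le> sqrt x * (l + 1)"
  proof -
    have "\<bar>x * (\<Sum>m=1..M. f m / (real m * real (m + 1))) - dens_const a q * x\<bar>
        = x * \<bar>dens_const a q - (\<Sum>m=1..M. f m / (real m * real (m + 1)))\<bar>"
    proof -
      have "x * (\<Sum>m=1..M. f m / (real m * real (m + 1))) - dens_const a q * x
          = - (x * (dens_const a q - (\<Sum>m=1..M. f m / (real m * real (m + 1)))))"
        by (simp only: right_diff_distrib mult.commute minus_diff_eq)
      then show ?thesis using x by (simp only: abs_minus_cancel abs_mult)
    qed
    also have "\<dots> \<le> x * ((ln (real (q * Suc M + a)) + 1) / real (Suc M))"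
      unfolding f_def using x by (intro mult_left_mono dens_const_tail) auto
    also have "\<dots> \<le> x * ((l + 1) / sqrt x)"
    proof (intro mult_left_mono frac_le add_mono ln_le)
      show "real (Suc M) \<le> x + 1" using M sqrt_x by simp
    qed (use M x l_nonneg sqrt_x in auto)
    also have "\<dots> = sqrt x * (l + 1)" 
    proof -
      have "x * ((l + 1) / sqrt x) = x / sqrt x * (l + 1)" by simp
      then show ?thesis using x by (simp only: real_div_sqrt)
    qed
    finally show ?thesis .
  qed
  have "\<bar>(\<Sum>n\<in>A. f (v n)) - dens_const a q * x\<bar> \<le> sqrt x * l + sqrt x * l + sqrt x * (l + 1)"
    using split large small tail by linarith
  also have "\<dots> = sqrt x * (3 * l + 1)" by (simp add: algebra_simps)
  finally show ?thesis unfolding A_def f_def v_def l_def .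
qed

text \<open>For \<open>x \<ge> 3 q\<close> the logarithm is at most \<open>2 log x\<close>, which
  gives \<open>7 = 3 * 2 + 1\<close>; the exponent \<open>1/2\<close> lies below
  \<open>(2 + \<epsilon>)/3\<close>.\<close>

lemma sum_floor_quotient_bigo:
  assumes "\<epsilon> > 0"
  shows "(\<lambda>x::real. (\<Sum>n\<in>{1..nat \<lfloor>x\<rfloor>}. mangoldt (q * nat \<lfloor>x / real n\<rfloor> + a) :: real) - dens_const a q * x)
       \<in> O[at_top](\<lambda>x. x powr ((2 + \<epsilon>) / 3) * (ln x) ^ 2)"
proof (rule bigoI[where c = 7])
  show "\<forall>\<^sub>F x in at_top. norm ((\<Sum>n\<in>{1..nat \<lfloor>x\<rfloor>}. mangoldt (q * nat \<lfloor>x / real n\<rfloor> + a) :: real) - dens_const a q * x)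
     \<le> 7 * norm (x powr ((2 + \<epsilon>) / 3) * (ln x) ^ 2)"
    using eventually_ge_at_top[of "3 * real q"]
  proof eventually_elim
    case (elim x)
    have x: "x \<ge> 3" using elim a_less a_pos by linarith
    have "exp 1 \<le> x" using exp_le x by linarith
    then have ln_x: "1 \<le> ln x" using x by (subst ln_ge_iff) auto
    have "3 * real q * x \<le> x * x" using elim x by (intro mult_right_mono) auto
    then have "ln (3 * real q * x) \<le> ln (x * x)" using x a_less by (intro ln_mono) auto
    also have "\<dots> = 2 * ln x" using x by (simp add: ln_mult)
    finally have "sqrt x * (3 * ln (3 * real q * x) + 1) \<le> sqrt x * (7 * ln x)"
      using ln_x x by (intro mult_left_mono) auto
    also have "\<dots> \<le> x powr ((2 + \<epsilon>) / 3) * (7 * (ln x) ^ 2)"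
    proof (rule mult_mono)
      have "sqrt x = x powr (1 / 2)" using x by (simp add: powr_half_sqrt)
      also have "\<dots> \<le> x powr ((2 + \<epsilon>) / 3)" using x assms by (intro powr_mono) auto
      finally show "sqrt x \<le> x powr ((2 + \<epsilon>) / 3)" .
      show "7 * ln x \<le> 7 * (ln x) ^ 2" using ln_x by (simp add: power2_eq_square)
    qed (use ln_x in auto)
    finally show ?case using sum_floor_quotient_error[of x] x by simp
  qed
qed

end

text \<open>Summability is part of the conclusion, so that \<open>dens_const\<close> is certified as
  the value of a convergent series.\<close>

theorem theorem1p2:
  fixes a q :: nat and \<epsilon> :: real
  assumes "0 < a" and "a < q" and "coprime a q" and "\<epsilon> > 0"
  shows "summable (\<lambda>n. mangoldt (q * Suc n + a) / (real (Suc n) * real (Suc n + 1)) :: real)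
     \<and> dens_const a q > 0
     \<and> (\<lambda>x::real. (\<Sum>n\<in>{1..nat \<lfloor>x\<rfloor>}. mangoldt (q * nat \<lfloor>x / real n\<rfloor> + a) :: real)
                    - dens_const a q * x)
       \<in> O[at_top](\<lambda>x. x powr ((2 + \<epsilon>) / 3) * (ln x) ^ 2)"
proof (intro conjI)
  show summable: "summable (\<lambda>n. mangoldt (q * Suc n + a) / (real (Suc n) * real (Suc n + 1)) :: real)"
    using assms(1,2) by (rule dens_summable)
  obtain m where m: "m > 0" "mangoldt (q * m + a) > (0::real)"
    using ex_mangoldt_progression_pos[OF assms(2,3)] by blast
  show "dens_const a q > 0"
    unfolding dens_const_def
  \<comment> \<open>The series is indexed from 0, so the term belonging to \<open>m\<close> stands
    at \<open>m - 1\<close>.\<close>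
  proof (rule suminf_pos2[OF summable, of "m - 1"])
    show "0 \<le> mangoldt (q * Suc n + a) / (real (Suc n) * real (Suc n + 1))" for n
      by (intro divide_nonneg_nonneg mult_nonneg_nonneg mangoldt_nonneg) auto
    show "0 < mangoldt (q * Suc (m - 1) + a) / (real (Suc (m - 1)) * real (Suc (m - 1) + 1))"
      using m by (intro divide_pos_pos) auto
  qed
  show "(\<lambda>x::real. (\<Sum>n\<in>{1..nat \<lfloor>x\<rfloor>}. mangoldt (q * nat \<lfloor>x / real n\<rfloor> + a) :: real) - dens_const a q * x)
       \<in> O[at_top](\<lambda>x. x powr ((2 + \<epsilon>) / 3) * (ln x) ^ 2)"
    using assms(1,2,4) by (rule sum_floor_quotient_bigo)
qed

end
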